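(* Let $\Omega\subseteq\mathbb{R}^d$ be open and let $f:\Omega\to\mathbb{R}$ be continuous. Assume that $\mathrm{hypo}(f)$ satisfies the $\rho(\cdot)$-exterior sphere condition for some continuous function $\rho:\Omega\to(0,\infty)$. Then for every $x\in\Omega$ the following hold. (i) The set $\partial^{*}f(x)\cup\partial^{*,\infty}f(x)$ is nonempty and $$(-\partial^*f(x),1)\cup(-\partial^{*,\infty}f(x),0)\subseteq N^{P}_{\mathrm{hypo}(f)}(x,f(x)).$$ (ii) Let $C(x)$ be any convex closed cone such that $(-\partial^*f(x),1)\cup(-\partial^{*,\infty}f(x),0)\subseteq C(x)\subseteq N^{P}_{\mathrm{hypo}(f)}(x,f(x))$. If a unit vector $(-\xi,\lambda)\in\mathbb{R}^d\times[0,\infty)$ belongs to an exposed ray of $C(x)$, then $$(-\xi,\lambda)\in\left\{\frac{\zeta}{|\zeta|}:\zeta\in(-\partial^*f(x),1)\right\}\cup(-\partial^{*,\infty}f(x),0).$$ (iii) If $N^{P}_{\mathrm{hypo}(f)}(x,f(x))$ is pointed, then it is closed and $$N^{P}_{\mathrm{hypo}(f)}(x,f(x))=\mathrm{co}\left\{\lambda v:\lambda\in[0,\infty),\ v\in(-\partial^{*,\infty}f(x),0)\cup(-\partial^{*}f(x),1)\right\}.$$ Moreover, $$\partial^{\infty}f(x)=\mathrm{co}\big[\partial^{*,\infty}f(x)\cup\{0\}\big],\qquad \partial^{P}f(x)=\mathrm{co}\big[\partial^{*}f(x)\big]+\partial^{\infty}f(x).$$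
   Context: $\mathrm{hypo}(f)=\{(z,\beta)\in\Omega\times\mathbb{R}:\beta\le f(z)\}$. For a set $Q$ and $x\in Q$, $v\in N^P_Q(x)$ (proximal normal) iff there is $\sigma\ge0$ with $v\cdot(y-x)\le\sigma|y-x|^2$ for all $y\in Q$; it is realized by a ball of radius $\rho$ if this holds with $\sigma=|v|/(2\rho)$. $\mathrm{hypo}(f)$ satisfies the $\rho(\cdot)$-exterior sphere condition if for every $x\in\Omega$ there is a nonzero $v_x\in N^P_{\mathrm{hypo}(f)}(x,f(x))$ realized by a ball (in $\mathbb{R}^{d+1}$) of radius $\rho(x)$. $\partial^Pf(x)=\{v\in\mathbb{R}^d:(-v,1)\in N^P_{\mathrm{hypo}(f)}(x,f(x))\}$ and $\partial^\infty f(x)=\{v\in\mathbb{R}^d:(-v,0)\in N^P_{\mathrm{hypo}(f)}(x,f(x))\}$. $\partial^*f(x)$ is the set of limits $\lim Df(x_n)$ with $x_n\in\Omega\setminus\{x\}$, $x_n\to x$, $f$ differentiable at $x_n$. $\partial^{*,\infty}f(x)$ is the set of $v\neq0$ for which there is such a sequence with $\frac{v}{|v|}=\lim\frac{Df(x_n)}{|Df(x_n)|}$ and $|Df(x_n)|\to\infty$. For $A\subseteq\mathbb{R}^d$ and $c\in\mathbb{R}$, $(-A,c)=\{(-a,c):a\in A\}$. A cone $C\subseteq\mathbb{R}^{d+1}$ (i.e. $\lambda v\in C$ for $v\in C$, $\lambda\ge0$) is pointed if $C\cap(-C)=\{0\}$. A half line $\mathbb{R}^+\zeta\subseteq C$ is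 an exposed ray of a convex cone $C$ if there is a unit vector $\bar v\in\mathbb{R}^{d+1}$ with $\zeta\cdot\bar v=0$ and $w\cdot\bar v<0$ for all $w\in C\setminus(\mathbb{R}^+\zeta\cup\{0\})$. $\mathrm{co}$ denotes the convex hull. *)

theory Defs
  imports "HOL-Analysis.Analysis"
begin

text \<open>
  Throughout, \<open>'a\<close> plays the role of $R^d$ and the product \<open>'a \<times> real\<close> (with the product inner
  product, hence the Euclidean norm) the role of $R^{d+1}$. A function on \<open>\<Omega>\<close> is rendered as a
  total function of which only the values on \<open>\<Omega>\<close> are used.
\<close>

definition hypo :: "'a set \<Rightarrow> ('a \<Rightarrow> real) \<Rightarrow> ('a \<times> real) set" where
  "hypo \<Omega> f = {(z, \<beta>). z \<in> \<Omega> \<and> \<beta> \<le> f z}"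

text \<open>Only meant for base points \<open>x \<in> Q\<close>.\<close>

definition proximal_normals :: "'b::real_inner set \<Rightarrow> 'b \<Rightarrow> 'b set" where
  "proximal_normals Q x =
     {v. \<exists>\<sigma>\<ge>0. \<forall>y\<in>Q. v \<bullet> (y - x) \<le> \<sigma> * (norm (y - x))\<^sup>2}"

definition realized_by_ball :: "'b::real_inner set \<Rightarrow> 'b \<Rightarrow> 'b \<Rightarrow> real \<Rightarrow> bool" where
  "realized_by_ball Q x v r \<longleftrightarrow>
     (\<forall>y\<in>Q. v \<bullet> (y - x) \<le> norm v / (2 * r) * (norm (y - x))\<^sup>2)"

definition hypo_exterior_sphere ::
    "'a::real_inner set \<Rightarrow> ('a \<Rightarrow> real) \<Rightarrow> ('a \<Rightarrow> real) \<Rightarrow> bool" where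
  "hypo_exterior_sphere \<Omega> f \<rho> \<longleftrightarrow>
     (\<forall>x\<in>\<Omega>. \<exists>v \<in> proximal_normals (hypo \<Omega> f) (x, f x).
        v \<noteq> 0 \<and> realized_by_ball (hypo \<Omega> f) (x, f x) v (\<rho> x))"

definition proximal_superdiff :: "'a::real_inner set \<Rightarrow> ('a \<Rightarrow> real) \<Rightarrow> 'a \<Rightarrow> 'a set" where
  "proximal_superdiff \<Omega> f x = {v. (- v, 1) \<in> proximal_normals (hypo \<Omega> f) (x, f x)}"

definition horizontal_superdiff :: "'a::real_inner set \<Rightarrow> ('a \<Rightarrow> real) \<Rightarrow> 'a \<Rightarrow> 'a set" where
  "horizontal_superdiff \<Omega> f x = {v. (- v, 0) \<in> proximal_normals (hypo \<Omega> f) (x, f x)}"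

text \<open>
  \<open>G n\<close> is the (unique) gradient $Df(X_n)$. Differentiability is taken with respect to the whole
  space, which is the intended notion because \<open>\<Omega>\<close> is always assumed open.
\<close>

definition gradient_sequence ::
    "'a::real_inner set \<Rightarrow> ('a \<Rightarrow> real) \<Rightarrow> 'a \<Rightarrow> (nat \<Rightarrow> 'a) \<Rightarrow> (nat \<Rightarrow> 'a) \<Rightarrow> bool" where
  "gradient_sequence \<Omega> f x X G \<longleftrightarrow>
     (\<forall>n. X n \<in> \<Omega> - {x} \<and> GDERIV f (X n) :> G n) \<and> X \<longlonglongrightarrow> x"

definition reachable_gradients :: "'a::real_inner set \<Rightarrow> ('a \<Rightarrow> real) \<Rightarrow> 'a \<Rightarrow> 'a set" where
  "reachable_gradients \<Omega> f x = {v. \<exists>X G. gradient_sequence \<Omega> f x X G \<and> G \<longlonglongrightarrow> v}"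

definition horizontal_reachable_gradients ::
    "'a::real_inner set \<Rightarrow> ('a \<Rightarrow> real) \<Rightarrow> 'a \<Rightarrow> 'a set" where
  "horizontal_reachable_gradients \<Omega> f x =
     {v. v \<noteq> 0 \<and> (\<exists>X G. gradient_sequence \<Omega> f x X G \<and>
           (\<lambda>n. G n /\<^sub>R norm (G n)) \<longlonglongrightarrow> v /\<^sub>R norm v \<and>
           filterlim (\<lambda>n. norm (G n)) at_top sequentially)}"

text \<open>The set $(-A, c)$.\<close>

definition neg_lift :: "'a::uminus set \<Rightarrow> real \<Rightarrow> ('a \<times> real) set" where
  "neg_lift A c = (\<lambda>a. (- a, c)) ` A"

text \<open>Only meant for cones.\<close>

definition pointed :: "'b::real_vector set \<Rightarrow> bool" where
  "pointed C \<longleftrightarrow> C \<inter> uminus ` C = {0}"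

definition half_line :: "'b::real_vector \<Rightarrow> 'b set" where
  "half_line \<zeta> = {t *\<^sub>R \<zeta> | t. 0 \<le> t}"

definition exposed_ray :: "'b::real_inner set \<Rightarrow> 'b set \<Rightarrow> bool" where
  "exposed_ray R C \<longleftrightarrow>
     (\<exists>\<zeta>. \<zeta> \<noteq> 0 \<and> R = half_line \<zeta> \<and> R \<subseteq> C \<and>
       (\<exists>v. norm v = 1 \<and> \<zeta> \<bullet> v = 0 \<and> (\<forall>w \<in> C - (R \<union> {0}). w \<bullet> v < 0)))"

end

theory Submission
  imports Defs
begin

text \<open>
  Where a smooth function touches the graph of $f$ from below, an exterior ball touches it from
  above, so $f$ is differentiable there. Minimisation therefore produces gradients in abundance,
  and a mean value inequality of Zagrodny type locates them: if $f(b) - f(a) > r$, some gradient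
  $G$ taken near the segment satisfies $G \cdot (b - a) \ge r$.

  Let $S$ be the compact set of limits at $x$ of unit normals $(-G, 1)/|(-G, 1)|$. Such normals
  are realized by balls of radius $\rho$, so $S$ consists of proximal normals. Conversely, if
  $\nu \neq 0$ is a proximal normal and $\nu \cdot v \ge 0$, then a perturbation of $(x, f(x)) + t v$ by
  $O(t^2)$ lies above the graph, and the mean value inequality gives $w \in S$ with $w \cdot v \ge 0$.
  Taking for $v$ the exposing direction proves (ii); taking for $v$ a direction separating $\nu$
  from the convex hull of $S$ proves (iii).
\<close>

section \<open>Calculus of proximal normals and of normals realized by balls\<close>

lemma proximal_normals_add:
  assumes "u \<in> proximal_normals Q x" "v \<in> proximal_normals Q x"
  shows "u + v \<in> proximal_normals Q x"
proof -
  obtain s t where "s \<ge> 0" "t \<ge> 0"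
    and s: "\<forall>y\<in>Q. u \<bullet> (y - x) \<le> s * (norm (y - x))\<^sup>2"
    and t: "\<forall>y\<in>Q. v \<bullet> (y - x) \<le> t * (norm (y - x))\<^sup>2"
    using assms by (auto simp: proximal_normals_def)
  have "(u + v) \<bullet> (y - x) \<le> (s + t) * (norm (y - x))\<^sup>2" if "y \<in> Q" for y
    using add_mono[OF s[rule_format, OF that] t[rule_format, OF that]]
    by (simp add: inner_add_left distrib_right)
  with \<open>s \<ge> 0\<close> \<open>t \<ge> 0\<close> show ?thesis
    unfolding proximal_normals_def by (auto intro!: exI[of _ "s + t"])
qed

lemma proximal_normals_scaleR:
  assumes "v \<in> proximal_normals Q x" "0 \<le> c"
  shows "c *\<^sub>R v \<in> proximal_normals Q x"
proof -
  obtain s where "s \<ge> 0" and s: "\<forall>y\<in>Q. v \<bullet> (y - x) \<le> s * (norm (y - x))\<^sup>2"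
    using assms by (auto simp: proximal_normals_def)
  have "(c *\<^sub>R v) \<bullet> (y - x) \<le> (c * s) * (norm (y - x))\<^sup>2" if "y \<in> Q" for y
    using mult_left_mono[OF s[rule_format, OF that] \<open>0 \<le> c\<close>] by (simp add: mult.assoc)
  with \<open>s \<ge> 0\<close> \<open>0 \<le> c\<close> show ?thesis
    unfolding proximal_normals_def by (auto intro!: exI[of _ "c * s"])
qed

lemma zero_in_proximal_normals: "0 \<in> proximal_normals Q x"
  by (auto simp: proximal_normals_def)

lemma convex_proximal_normals: "convex (proximal_normals Q x)"
  by (simp add: convex_def proximal_normals_add proximal_normals_scaleR)

lemma realized_by_ball_scaleR:
  assumes "realized_by_ball Q x v r" "0 \<le> c"
  shows "realized_by_ball Q x (c *\<^sub>R v) r"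
  unfolding realized_by_ball_def
proof
  fix y assume "y \<in> Q"
  with assms have "c * (v \<bullet> (y - x)) \<le> c * (norm v / (2 * r) * (norm (y - x))\<^sup>2)"
    by (intro mult_left_mono) (auto simp: realized_by_ball_def)
  then show "(c *\<^sub>R v) \<bullet> (y - x) \<le> norm (c *\<^sub>R v) / (2 * r) * (norm (y - x))\<^sup>2"
    using assms(2) by (simp add: mult.assoc)
qed

lemma realized_by_ball_imp_proximal_normal:
  assumes "realized_by_ball Q x v r" "0 < r"
  shows "v \<in> proximal_normals Q x"
  using assms unfolding realized_by_ball_def proximal_normals_def
  by (auto intro!: exI[of _ "norm v / (2 * r)"])

text \<open>Limits of proximal normals need not be proximal, since the constants \<sigma> may blow
  up. Here the radii control the constants, so for each fixed \<open>y\<close> the inequality passes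
  to the limit.\<close>

lemma realized_by_ball_limit:
  assumes "\<And>n. realized_by_ball Q (p n) (v n) (r n)"
    and "p \<longlonglongrightarrow> q" "v \<longlonglongrightarrow> w" "r \<longlonglongrightarrow> s" "s \<noteq> 0"
  shows "realized_by_ball Q q w s"
  unfolding realized_by_ball_def
proof
  fix y assume y: "y \<in> Q"
  have "(\<lambda>n. v n \<bullet> (y - p n)) \<longlonglongrightarrow> w \<bullet> (y - q)"
    using assms by (intro tendsto_intros)
  moreover have "(\<lambda>n. norm (v n) / (2 * r n) * (norm (y - p n))\<^sup>2)
      \<longlonglongrightarrow> norm w / (2 * s) * (norm (y - q))\<^sup>2"
    using assms by (intro tendsto_intros) auto
  moreover have "v n \<bullet> (y - p n) \<le> norm (v n) / (2 * r n) * (norm (y - p n))\<^sup>2" for n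
    using assms(1) y by (simp add: realized_by_ball_def)
  ultimately show "w \<bullet> (y - q) \<le> norm w / (2 * s) * (norm (y - q))\<^sup>2"
    by (intro LIMSEQ_le) auto
qed

section \<open>Contact from below and differentiability\<close>

text \<open>Near \<open>x\<close> the hypograph of \<open>g\<close> lies inside that of
  \<open>f\<close>, so the normal is also proximal to the hypograph of \<open>g\<close>, where
  differentiability leaves only the nonnegative multiples of \<open>(- G, 1)\<close>.\<close>

lemma proximal_normal_hypo_parallel:
  fixes f g :: "'a::real_inner \<Rightarrow> real"
  assumes v: "(a, b) \<in> proximal_normals (hypo \<Omega> f) (x, f x)"
    and "open \<Omega>" "x \<in> \<Omega>"
    and le: "\<forall>\<^sub>F y in nhds x. g y \<le> f y" and eq: "g x = f x"
    and deriv: "GDERIV g x :> G"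
  shows "0 \<le> b" "a = - (b *\<^sub>R G)"
proof -
  obtain s where "s \<ge> 0"
    and s: "\<forall>y\<in>hypo \<Omega> f. (a, b) \<bullet> (y - (x, f x)) \<le> s * (norm (y - (x, f x)))\<^sup>2"
    using v by (auto simp: proximal_normals_def)
  have s': "a \<bullet> (y - x) + b * (\<beta> - f x) \<le> s * ((norm (y - x))\<^sup>2 + (\<beta> - f x)\<^sup>2)"
    if "y \<in> \<Omega>" "\<beta> \<le> f y" for y \<beta>
    using s[rule_format, of "(y, \<beta>)"] that by (simp add: hypo_def norm_Pair)
  show "0 \<le> b"
  proof (rule ccontr)
    assume "\<not> 0 \<le> b"
    \<comment> \<open>Going straight down by \<open>t\<close> gains
      \<open>- b * t = (s + 1) * t\<^sup>2\<close>, more than the allowed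
      \<open>s * t\<^sup>2\<close>.\<close>
    define t where "t = - b / (s + 1)"
    have "t > 0" using \<open>\<not> 0 \<le> b\<close> \<open>s \<ge> 0\<close> by (simp add: t_def divide_neg_pos)
    have "- b * t \<le> s * t\<^sup>2"
      using s'[of x "f x - t"] \<open>x \<in> \<Omega>\<close> \<open>t > 0\<close> by simp
    then have "t * - b \<le> t * (s * t)" by (simp add: power2_eq_square mult_ac)
    then have "- b \<le> s * t" using \<open>t > 0\<close> by (rule mult_left_le_imp_le)
    also have "\<dots> < (s + 1) * t" using \<open>t > 0\<close> by simp
    also have "\<dots> = - b" using \<open>s \<ge> 0\<close> by (simp add: t_def)
    finally show False by simp
  qed
  have key: "(a + b *\<^sub>R G) \<bullet> h \<le> 0" for h
  proof -
    \<comment> \<open>The graph of \<open>g\<close> above the ray \<open>x + t *\<^sub>R h\<close>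
      stays in the hypograph for small \<open>t\<close>. Dividing the normal inequality by
      \<open>t\<close> and letting \<open>t\<close> tend to 0 from the right leaves the first-order
      terms only.\<close>
    define k where "k t = (g (x + t *\<^sub>R h) - g x) / t" for t
    have "((\<lambda>t. g (x + t *\<^sub>R h)) has_derivative (\<lambda>t. (t *\<^sub>R h) \<bullet> G)) (at 0)"
      using deriv unfolding gderiv_def
      by (intro has_derivative_compose[of "\<lambda>t. x + t *\<^sub>R h" "\<lambda>t. t *\<^sub>R h" 0 UNIV g, simplified])
        (auto intro!: derivative_eq_intros)
    then have "((\<lambda>t. g (x + t *\<^sub>R h)) has_field_derivative (h \<bullet> G)) (at 0)"
      by (simp add: has_field_derivative_def mult_commute_abs)
    then have k0: "(k \<longlongrightarrow> h \<bullet> G) (at_right 0)"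
      unfolding DERIV_def k_def by (simp add: filterlim_at_split)
    have lim: "((\<lambda>t::real. x + t *\<^sub>R h) \<longlongrightarrow> x) (at_right 0)"
      by (auto intro!: tendsto_eq_intros)
    have "\<forall>\<^sub>F t in at_right 0. g (x + t *\<^sub>R h) \<le> f (x + t *\<^sub>R h)"
      by (rule eventually_compose_filterlim[OF le lim])
    moreover have "\<forall>\<^sub>F t in at_right 0. x + t *\<^sub>R h \<in> \<Omega>"
      using assms lim by (auto dest: topological_tendstoD)
    ultimately have "\<forall>\<^sub>F t in at_right 0. a \<bullet> h + b * k t \<le> s * (t * ((norm h)\<^sup>2 + (k t)\<^sup>2))"
      using eventually_at_right_less[of 0]
    proof eventually_elim
      case (elim t)
      have "g (x + t *\<^sub>R h) - f x = t * k t" using elim eq by (simp add: k_def)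
      then have "t * (a \<bullet> h + b * k t) \<le> t * (s * (t * ((norm h)\<^sup>2 + (k t)\<^sup>2)))"
        using s'[OF elim(2,1)] elim
        by (simp add: algebra_simps power2_eq_square)
      then show ?case using elim by simp
    qed
    moreover have "((\<lambda>t. a \<bullet> h + b * k t) \<longlongrightarrow> a \<bullet> h + b * (h \<bullet> G)) (at_right 0)"
      by (intro tendsto_intros k0)
    moreover have "((\<lambda>t. s * (t * ((norm h)\<^sup>2 + (k t)\<^sup>2))) \<longlongrightarrow>
        s * (0 * ((norm h)\<^sup>2 + (h \<bullet> G)\<^sup>2))) (at_right 0)"
      by (intro tendsto_intros k0)
    ultimately have "a \<bullet> h + b * (h \<bullet> G) \<le> s * (0 * ((norm h)\<^sup>2 + (h \<bullet> G)\<^sup>2))"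
      by (intro tendsto_le[OF trivial_limit_at_right_real])
    then show ?thesis by (simp add: inner_add_left inner_commute[of G])
  qed
  have "a + b *\<^sub>R G = 0" using key[of "a + b *\<^sub>R G"] by (metis inner_eq_zero_iff inner_ge_zero order_antisym)
  then show "a = - (b *\<^sub>R G)" by (simp add: eq_neg_iff_add_eq_0)
qed

text \<open>The lower bound is quadratic by assumption. The normal gives an upper bound whose error
  contains \<open>(f y - f x)\<^sup>2\<close> besides \<open>(norm (y - x))\<^sup>2\<close>.
  Continuity makes the former small enough to be absorbed, which first yields linear growth of
  \<open>f\<close> at \<open>x\<close> and then a quadratic error on both sides.\<close>

lemma GDERIV_if_touched_below:
  fixes f :: "'a::real_inner \<Rightarrow> real"
  assumes v: "v \<in> proximal_normals (hypo \<Omega> f) (x, f x)" "v \<noteq> 0"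
    and "open \<Omega>" "x \<in> \<Omega>" "isCont f x"
    and below: "\<forall>\<^sub>F y in nhds x. f x + z \<bullet> (y - x) - N * (norm (y - x))\<^sup>2 \<le> f y"
  shows "GDERIV f x :> z"
proof -
  obtain a b where ab: "v = (a, b)" by (cases v)
  have "GDERIV (\<lambda>y. f x + z \<bullet> (y - x) - N * ((y - x) \<bullet> (y - x))) x :> z"
    unfolding gderiv_def by (auto intro!: derivative_eq_intros simp: inner_commute)
  then have dg: "GDERIV (\<lambda>y. f x + z \<bullet> (y - x) - N * (norm (y - x))\<^sup>2) x :> z"
    by (simp add: power2_norm_eq_inner)
  note par = proximal_normal_hypo_parallel[OF v(1)[unfolded ab] assms(3,4) below _ dg, simplified]
  \<comment> \<open>If \<open>b\<close> vanished, then \<open>a = - (b *\<^sub>R z)\<close> would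
    vanish too, against \<open>v \<noteq> 0\<close>.\<close>
  have "b > 0" using par v(2) ab by (cases "b = 0") (auto simp: zero_prod_def)
  obtain s where "s \<ge> 0"
    and s: "\<forall>y\<in>hypo \<Omega> f. (a, b) \<bullet> (y - (x, f x)) \<le> s * (norm (y - (x, f x)))\<^sup>2"
    using v ab by (auto simp: proximal_normals_def)
  define c where "c = s / b"
  have "c \<ge> 0" using \<open>s \<ge> 0\<close> \<open>b > 0\<close> by (simp add: c_def)
  have upper: "f y - f x - z \<bullet> (y - x) \<le> c * ((norm (y - x))\<^sup>2 + (f y - f x)\<^sup>2)" if "y \<in> \<Omega>" for y
  proof -
    have "b * (f y - f x - z \<bullet> (y - x)) \<le> s * ((norm (y - x))\<^sup>2 + (f y - f x)\<^sup>2)"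
      using s[rule_format, of "(y, f y)"] that par
      by (simp add: hypo_def norm_Pair algebra_simps)
    then show ?thesis using \<open>b > 0\<close> by (simp add: c_def field_simps)
  qed
  \<comment> \<open>\<open>M\<close> will bound the growth,
    \<open>\<bar>f y - f x\<bar> \<le> M * norm (y - x)\<close>. Inserting this into the upper bound
    gives the constant \<open>L\<close> of the two-sided estimate.\<close>
  define M where "M = 2 * norm z + 2 * c + \<bar>N\<bar>"
  define L where "L = c * (1 + M\<^sup>2) + \<bar>N\<bar>"
  have "\<forall>\<^sub>F y in nhds x. y \<in> \<Omega>" using assms by (simp add: eventually_nhds_in_open)
  moreover have "\<forall>\<^sub>F y in nhds x. dist (f y) (f x) < 1 / (2 * (c + 1))"
    using \<open>isCont f x\<close> \<open>c \<ge> 0\<close> by (intro tendstoD) (auto simp: isCont_def tendsto_at_iff_tendsto_nhds)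
  moreover have "\<forall>\<^sub>F y in nhds x. dist y x < 1"
    by (auto simp: eventually_nhds_metric intro: exI[of _ 1])
  ultimately have "\<forall>\<^sub>F y in nhds x. \<bar>f y - f x - z \<bullet> (y - x)\<bar> \<le> L * (norm (y - x))\<^sup>2"
    using below
  proof eventually_elim
    case (elim y)
    define h where "h = norm (y - x)"
    define k where "k = f y - f x"
    define q where "q = z \<bullet> (y - x)"
    have "0 \<le> h" "h \<le> 1" using elim by (auto simp: h_def dist_norm)
    then have hh: "h\<^sup>2 \<le> h" by (simp add: power2_eq_square mult_left_le)
    have q: "\<bar>q\<bar> \<le> norm z * h" unfolding q_def h_def by (rule Cauchy_Schwarz_ineq2)
    have lo: "q - \<bar>N\<bar> * h\<^sup>2 \<le> k"
      using elim(4) abs_ge_self[of "N"] mult_right_mono[of N "\<bar>N\<bar>" "h\<^sup>2"]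
      unfolding h_def k_def q_def by simp
    have up: "k - q \<le> c * h\<^sup>2 + c * k\<^sup>2"
      using upper[OF elim(1)] unfolding h_def k_def q_def by (simp add: distrib_left)
    \<comment> \<open>The neighbourhood was chosen so that \<open>c * \<bar>k\<bar>\<close> is at
      most 1/2; hence \<open>c * k\<^sup>2\<close> is at most half of \<open>\<bar>k\<bar>\<close>
      and can be absorbed. Using \<open>c + 1\<close> keeps the threshold positive when
      \<open>c = 0\<close>.\<close>
    have "c * \<bar>k\<bar> \<le> (c + 1) * (1 / (2 * (c + 1)))"
      using elim(2) \<open>c \<ge> 0\<close> unfolding k_def dist_real_def by (intro mult_mono) auto
    also have "\<dots> = 1 / 2" using \<open>c \<ge> 0\<close> by simp
    finally have "c * \<bar>k\<bar> * \<bar>k\<bar> \<le> 1 / 2 * \<bar>k\<bar>" by (intro mult_right_mono) auto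
    then have ck: "c * k\<^sup>2 \<le> \<bar>k\<bar> / 2" by (simp add: power2_eq_square mult.assoc)
    have ch: "c * h\<^sup>2 \<le> c * h" "\<bar>N\<bar> * h\<^sup>2 \<le> \<bar>N\<bar> * h"
      using hh \<open>c \<ge> 0\<close> by (auto intro: mult_left_mono)
    have nn: "0 \<le> norm z * h" "0 \<le> c * h" "0 \<le> \<bar>N\<bar> * h" using \<open>0 \<le> h\<close> \<open>c \<ge> 0\<close> by auto
    have "\<bar>k\<bar> \<le> 2 * (norm z * h) + 2 * (c * h) + \<bar>N\<bar> * h"
      using q lo up ck ch nn by linarith
    then have "\<bar>k\<bar> \<le> M * h" by (simp add: M_def algebra_simps)
    then have "k\<^sup>2 \<le> (M * h)\<^sup>2" by (metis abs_le_square_iff abs_ge_zero abs_of_nonneg order_trans)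
    then have "c * k\<^sup>2 \<le> c * (M\<^sup>2 * h\<^sup>2)"
      using \<open>c \<ge> 0\<close> by (intro mult_left_mono) (auto simp: power_mult_distrib)
    moreover have "0 \<le> c * h\<^sup>2 + c * (M\<^sup>2 * h\<^sup>2)" "0 \<le> \<bar>N\<bar> * h\<^sup>2" using \<open>c \<ge> 0\<close> by auto
    ultimately have "\<bar>k - q\<bar> \<le> c * h\<^sup>2 + c * (M\<^sup>2 * h\<^sup>2) + \<bar>N\<bar> * h\<^sup>2"
      using up lo by linarith
    then show ?case by (simp add: L_def h_def k_def q_def algebra_simps)
  qed
  then obtain e where "e > 0"
    and e: "\<And>y. dist y x < e \<Longrightarrow> \<bar>f y - f x - z \<bullet> (y - x)\<bar> \<le> L * (norm (y - x))\<^sup>2"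
    by (auto simp: eventually_nhds_metric)
  show ?thesis
    unfolding gderiv_def
  proof (rule has_derivativeI_sandwich[OF \<open>e > 0\<close>, where H = "\<lambda>y. L * norm (y - x)"])
    show "bounded_linear (\<lambda>h. h \<bullet> z)" by (rule bounded_linear_inner_left)
    show "norm (f y - f x - (y - x) \<bullet> z) / norm (y - x) \<le> L * norm (y - x)"
      if "y \<noteq> x" "dist y x < e" for y
      using e[OF that(2)] that(1)
      by (simp add: field_simps power2_eq_square inner_commute)
    show "((\<lambda>y. L * norm (y - x)) \<longlongrightarrow> 0) (at x)"
      by (auto intro!: tendsto_eq_intros)
  qed
qed


section \<open>A mean value inequality by penalization\<close>

lemma norm_diff_scaleR_power2:
  "(norm (u - h *\<^sub>R d))\<^sup>2 = (norm u)\<^sup>2 - 2 * h * (u \<bullet> d) + h\<^sup>2 * (norm d)\<^sup>2"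
  for u d :: "'a::real_inner"
  unfolding power2_norm_eq_inner
  by (simp add: inner_diff inner_commute[of d u] power2_eq_square algebra_simps)

text \<open>
  A mean value inequality of Zagrodny type: the slope is produced by minimising
  $f(y) + N |y - a - t (b - a)|^2 - r t$ over $(y, t)$ for a large penalty $N$. The strict
  inequality keeps the minimising $t$ away from 1, so that optimality in $t$ gives
  $z \cdot (b - a) \ge r$.
\<close>

lemma mean_value_lower_slope:
  fixes f :: "'a::euclidean_space \<Rightarrow> real"
  assumes cont: "continuous_on (cball c R) f"
    and ab: "a \<in> ball c R" "b \<in> ball c R"
    and r: "r < f b - f a"
  obtains x z N where "x \<in> ball c R" "r \<le> z \<bullet> (b - a)"
    "\<And>y. y \<in> cball c R \<Longrightarrow> f x + z \<bullet> (y - x) - N * (norm (y - x))\<^sup>2 \<le> f y"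
proof -
  define D where "D = b - a"
  define p where "p t = a + t *\<^sub>R D" for t
  define e where "e = (f b - f a - r) / 2"
  have "e > 0" using r by (simp add: e_def)
  have "uniformly_continuous_on (cball c R) f"
    using cont by (simp add: compact_uniformly_continuous)
  then obtain d0 where "d0 > 0"
    and d0: "\<And>u v. \<lbrakk>u \<in> cball c R; v \<in> cball c R; dist v u < d0\<rbrakk> \<Longrightarrow> dist (f v) (f u) < e"
    unfolding uniformly_continuous_on_def using \<open>e > 0\<close> by metis
  \<comment> \<open>The segment from \<open>a\<close> to \<open>b\<close> lies in the closed ball of
    radius \<open>m < R\<close>, so a minimiser closer than \<open>R - m\<close> to it is an
    interior point.\<close>
  define m where "m = max (dist c a) (dist c b)"
  have "m < R" using ab by (simp add: m_def)
  define d where "d = min d0 (R - m)"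
  have "d > 0" using \<open>d0 > 0\<close> \<open>m < R\<close> by (simp add: d_def)
  have p_in: "p t \<in> cball c m" if "t \<in> {0..1}" for t
  proof -
    have "p t = (1 - t) *\<^sub>R a + t *\<^sub>R b" by (simp add: p_def D_def algebra_simps)
    moreover have "a \<in> cball c m" "b \<in> cball c m" by (auto simp: m_def)
    ultimately show ?thesis
      using that convexD[OF convex_cball, of a c m b "1 - t" t] by simp
  qed
  have p_in': "p t \<in> cball c R" if "t \<in> {0..1}" for t
    using p_in[OF that] \<open>m < R\<close> by simp
  have "bounded (f ` cball c R)"
    using cont by (intro compact_imp_bounded compact_continuous_image) auto
  then obtain M where M: "\<And>y. y \<in> cball c R \<Longrightarrow> \<bar>f y\<bar> \<le> M"
    unfolding bounded_iff by (metis imageI real_norm_def)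
  \<comment> \<open>Comparison with the value of \<open>F\<close> at \<open>(a, 0)\<close> bounds
    the penalty strictly below \<open>2 * M + \<bar>r\<bar> + 1 = N * d\<^sup>2\<close>, which
    forces the minimiser to be closer than \<open>d\<close> to the segment.\<close>
  define N where "N = (2 * M + \<bar>r\<bar> + 1) / d\<^sup>2"
  define F where "F q = f (fst q) + N * (norm (fst q - p (snd q)))\<^sup>2 - r * snd q" for q
  have "continuous_on (cball c R \<times> {0..1}) F"
    unfolding F_def p_def
    by (intro continuous_intros continuous_on_compose2[OF cont]) auto
  moreover have "c \<in> cball c R" using ab zero_le_dist[of c a] by (simp del: zero_le_dist)
  ultimately obtain q where q: "q \<in> cball c R \<times> {0..1}"
    and qmin: "\<And>q'. q' \<in> cball c R \<times> {0..1} \<Longrightarrow> F q \<le> F q'"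
    using continuous_attains_inf[of "cball c R \<times> {0..1::real}" F] by (auto simp: compact_Times)
  obtain x t where xt: "q = (x, t)" by (cases q)
  have x: "x \<in> cball c R" and t: "t \<in> {0..1}" using q xt by auto
  have min: "f x + N * (norm (x - p t))\<^sup>2 - r * t \<le> f y + N * (norm (y - p s))\<^sup>2 - r * s"
    if "y \<in> cball c R" "s \<in> {0..1}" for y s
    using qmin[of "(y, s)"] that by (simp add: F_def xt)
  have a_min: "f x + N * (norm (x - p t))\<^sup>2 - r * t \<le> f a"
    using min[of a 0] ab by (simp add: p_def)
  have "r * t \<le> \<bar>r\<bar> * t" using t by (intro mult_right_mono) auto
  also have "\<dots> \<le> \<bar>r\<bar>" using t by (simp add: mult_left_le)
  finally have "r * t \<le> \<bar>r\<bar>" .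
  then have "N * (norm (x - p t))\<^sup>2 < 2 * M + \<bar>r\<bar> + 1"
    using a_min M[OF x] M[of a] ab by (simp add: less_imp_le)
  moreover have "2 * M + \<bar>r\<bar> + 1 = N * d\<^sup>2" using \<open>d > 0\<close> by (simp add: N_def)
  moreover have "N > 0" using \<open>d > 0\<close> M[OF x] by (auto simp: N_def intro!: divide_pos_pos)
  ultimately have "(norm (x - p t))\<^sup>2 < d\<^sup>2" by simp
  then have close: "norm (x - p t) < d" using \<open>d > 0\<close> by (simp add: power_less_imp_less_base)
  have "dist c x \<le> dist c (p t) + dist (p t) x" by (rule dist_triangle)
  also have "\<dots> < m + (R - m)"
    using p_in[OF t] close by (intro add_le_less_mono) (auto simp: d_def dist_norm norm_minus_commute)
  finally have x_ball: "x \<in> ball c R" by simp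
  have "t \<noteq> 1"
  proof
    assume "t = 1"
    then have pt: "p t = b" by (simp add: p_def D_def)
    then have "dist (f x) (f b) < e"
      using d0[of b x] x ab close by (auto simp: d_def dist_norm)
    moreover have "0 \<le> N * (norm (x - p t))\<^sup>2" using \<open>N > 0\<close> by simp
    ultimately have "f b - e - r < f a" using a_min \<open>t = 1\<close> by (simp add: dist_real_def)
    then show False using r by (simp add: e_def field_simps)
  qed
  \<comment> \<open>Minus the gradient of the penalty in \<open>y\<close>, taken at the minimiser.
    With \<open>t\<close> fixed, minimality in \<open>y\<close> gives quadratic contact from below
    with this slope.\<close>
  define z where "z = - (2 * N) *\<^sub>R (x - p t)"
  \<comment> \<open>Only forward steps \<open>t + h\<close> are used, because the minimising
    \<open>t\<close> may be 0; \<open>t \<noteq> 1\<close> leaves room for them.\<close>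
  have "r \<le> z \<bullet> (b - a)"
  proof -
    have "\<forall>\<^sub>F h in at_right (0::real). h < 1 - t"
      using t \<open>t \<noteq> 1\<close> by (intro order_tendstoD(2)[OF tendsto_ident_at]) auto
    then have "\<forall>\<^sub>F h in at_right (0::real). r \<le> z \<bullet> D + N * h * (norm D)\<^sup>2"
      using eventually_at_right_less[of 0]
    proof eventually_elim
      case (elim h)
      have "p (t + h) = p t + h *\<^sub>R D" by (simp add: p_def algebra_simps)
      then have "x - p (t + h) = (x - p t) - h *\<^sub>R D" by simp
      then have "(norm (x - p (t + h)))\<^sup>2
          = (norm (x - p t))\<^sup>2 - 2 * h * ((x - p t) \<bullet> D) + h\<^sup>2 * (norm D)\<^sup>2"
        by (simp only: norm_diff_scaleR_power2)
      then have diff: "(norm (x - p (t + h)))\<^sup>2 - (norm (x - p t))\<^sup>2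
          = h * (h * (norm D)\<^sup>2 - 2 * ((x - p t) \<bullet> D))"
        by (simp add: right_diff_distrib power2_eq_square)
      have "h * r \<le> N * ((norm (x - p (t + h)))\<^sup>2 - (norm (x - p t))\<^sup>2)"
        using min[OF x, of "t + h"] elim t by (simp add: algebra_simps)
      also have "\<dots> = h * (z \<bullet> D + N * h * (norm D)\<^sup>2)"
        unfolding diff z_def by (simp add: algebra_simps)
      finally have "h * r \<le> h * (z \<bullet> D + N * h * (norm D)\<^sup>2)" .
      then show ?case using elim by simp
    qed
    moreover have "((\<lambda>h. z \<bullet> D + N * h * (norm D)\<^sup>2) \<longlongrightarrow> z \<bullet> D + N * 0 * (norm D)\<^sup>2) (at_right 0)"
      by (intro tendsto_intros)
    ultimately have "r \<le> z \<bullet> D + N * 0 * (norm D)\<^sup>2"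
      by (intro tendsto_lowerbound[OF _ _ trivial_limit_at_right_real])
    then show ?thesis by (simp add: D_def)
  qed
  moreover have "f x + z \<bullet> (y - x) - N * (norm (y - x))\<^sup>2 \<le> f y" if "y \<in> cball c R" for y
  proof -
    have eq: "y - p t = (x - p t) - (- 1) *\<^sub>R (y - x)" by simp
    have "(norm (y - p t))\<^sup>2
        = (norm (x - p t))\<^sup>2 + 2 * ((x - p t) \<bullet> (y - x)) + (norm (y - x))\<^sup>2"
      by (subst eq, subst norm_diff_scaleR_power2) simp
    then have "N * (norm (y - p t))\<^sup>2
        = N * (norm (x - p t))\<^sup>2 - z \<bullet> (y - x) + N * (norm (y - x))\<^sup>2"
      by (simp add: z_def distrib_left)
    then show ?thesis using min[OF that t] by simp
  qed
  ultimately show thesis using that[OF x_ball] by blast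
qed


section \<open>Unit graph normals and their limits\<close>

text \<open>Normalizing puts bounded and unbounded gradients on one compact sphere, so that finite
  and horizontal limits are treated together. The point \<open>x\<close> is excluded, as in
  \<open>gradient_sequence\<close>.\<close>

definition unit_graph_normals ::
    "'a::real_inner set \<Rightarrow> ('a \<Rightarrow> real) \<Rightarrow> 'a \<Rightarrow> real \<Rightarrow> ('a \<times> real) set" where
  "unit_graph_normals \<Omega> f x e =
     {sgn (- G, 1) | X G. X \<in> \<Omega> - {x} \<and> dist X x < e \<and> GDERIV f X :> G}"

text \<open>An intersection of closures makes compactness immediate;
  \<open>limiting_normal_sequence\<close> recovers the sequences.\<close>

definition limiting_normals ::
    "'a::real_inner set \<Rightarrow> ('a \<Rightarrow> real) \<Rightarrow> 'a \<Rightarrow> ('a \<times> real) set" where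
  "limiting_normals \<Omega> f x = (\<Inter>e\<in>{0<..}. closure (unit_graph_normals \<Omega> f x e))"

lemma norm_unit_graph_normal: "u \<in> unit_graph_normals \<Omega> f x e \<Longrightarrow> norm u = 1"
  by (auto simp: unit_graph_normals_def norm_sgn zero_prod_def)

lemma unit_graph_normals_mono:
  "e \<le> e' \<Longrightarrow> unit_graph_normals \<Omega> f x e \<subseteq> unit_graph_normals \<Omega> f x e'"
  unfolding unit_graph_normals_def by force

lemma limiting_normals_subset_sphere: "limiting_normals \<Omega> f x \<subseteq> sphere 0 1"
proof -
  have "closure (unit_graph_normals \<Omega> f x 1) \<subseteq> sphere 0 1"
    by (intro closure_minimal) (auto simp: norm_unit_graph_normal sphere_def dist_norm intro!: closed_Collect_eq continuous_intros)
  moreover have "limiting_normals \<Omega> f x \<subseteq> closure (unit_graph_normals \<Omega> f x 1)"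
    unfolding limiting_normals_def by (rule INT_lower) simp
  ultimately show ?thesis by blast
qed

lemma compact_limiting_normals:
  fixes f :: "'a::euclidean_space \<Rightarrow> real"
  shows "compact (limiting_normals \<Omega> f x)"
  unfolding compact_eq_bounded_closed
proof
  show "bounded (limiting_normals \<Omega> f x)"
    by (rule bounded_subset[OF bounded_sphere limiting_normals_subset_sphere])
  show "closed (limiting_normals \<Omega> f x)"
    unfolding limiting_normals_def by (intro closed_INT) simp
qed

lemma limiting_normal_sequence:
  assumes "w \<in> limiting_normals \<Omega> f x"
  obtains X G where "gradient_sequence \<Omega> f x X G" "(\<lambda>n. sgn (- G n, 1)) \<longlonglongrightarrow> w"
proof -
  have "\<exists>X G. X \<in> \<Omega> - {x} \<and> dist X x < 1 / real (Suc n) \<and> GDERIV f X :> G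
      \<and> dist (sgn (- G, 1)) w < 1 / real (Suc n)" for n
  proof -
    have "w \<in> closure (unit_graph_normals \<Omega> f x (1 / real (Suc n)))"
      using assms by (auto simp: limiting_normals_def)
    then obtain u where "u \<in> unit_graph_normals \<Omega> f x (1 / real (Suc n))"
      "dist u w < 1 / real (Suc n)"
      unfolding closure_approachable by (meson of_nat_0_less_iff zero_less_Suc zero_less_divide_1_iff)
    then show ?thesis by (auto simp: unit_graph_normals_def)
  qed
  then obtain X G where XG: "\<And>n. X n \<in> \<Omega> - {x}" "\<And>n. dist (X n) x < 1 / real (Suc n)"
    "\<And>n. GDERIV f (X n) :> G n" "\<And>n. dist (sgn (- G n, 1)) w < 1 / real (Suc n)"
    by metis
  have "X \<longlonglongrightarrow> x"
    by (rule tendsto_dist_iff[THEN iffD2], rule tendsto_sandwich[OF _ _ tendsto_const LIMSEQ_Suc[OF lim_1_over_n]])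
      (use XG(2) in \<open>auto intro!: always_eventually less_imp_le\<close>)
  moreover have "(\<lambda>n. sgn (- G n, 1)) \<longlonglongrightarrow> w"
    by (rule tendsto_dist_iff[THEN iffD2], rule tendsto_sandwich[OF _ _ tendsto_const LIMSEQ_Suc[OF lim_1_over_n]])
      (use XG(4) in \<open>auto intro!: always_eventually less_imp_le\<close>)
  ultimately show thesis using that[of X G] XG(1,3) by (simp add: gradient_sequence_def)
qed

text \<open>Compactness of the unit sphere supplies a convergent subsequence, and the tolerance
  \<open>e\<close> disappears in the limit. With \<open>v = 0\<close> this yields
  nonemptiness.\<close>

lemma limiting_normal_exists:
  fixes f :: "'a::euclidean_space \<Rightarrow> real"
  assumes "\<And>e. 0 < e \<Longrightarrow> \<exists>u\<in>unit_graph_normals \<Omega> f x e. - e \<le> u \<bullet> v"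
  shows "\<exists>w\<in>limiting_normals \<Omega> f x. 0 \<le> w \<bullet> v"
proof -
  have "\<exists>u\<in>unit_graph_normals \<Omega> f x (1 / real (Suc n)). - (1 / real (Suc n)) \<le> u \<bullet> v" for n
    by (rule assms) simp
  then obtain u where u: "\<And>n. u n \<in> unit_graph_normals \<Omega> f x (1 / real (Suc n))"
    "\<And>n. - (1 / real (Suc n)) \<le> u n \<bullet> v"
    by metis
  have "u n \<in> sphere 0 1" for n using norm_unit_graph_normal[OF u(1)] by simp
  then obtain w k where k: "strict_mono k" and w: "(u \<circ> k) \<longlonglongrightarrow> w"
    using compact_sphere[of "0 :: 'a \<times> real" 1] unfolding compact_def by metis
  have inv: "(\<lambda>n. 1 / real (Suc (k n))) \<longlonglongrightarrow> 0"
    using LIMSEQ_subseq_LIMSEQ[OF LIMSEQ_Suc[OF lim_1_over_n] k] by (simp add: o_def)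
  have "w \<in> closure (unit_graph_normals \<Omega> f x e)" if "e > 0" for e
  proof (rule Lim_in_closed_set[OF closed_closure _ _ w])
    have "\<forall>\<^sub>F n in sequentially. 1 / real (Suc (k n)) < e"
      using inv that by (rule order_tendstoD)
    then show "\<forall>\<^sub>F n in sequentially. (u \<circ> k) n \<in> closure (unit_graph_normals \<Omega> f x e)"
    proof eventually_elim
      case (elim n)
      then show ?case
        using u(1)[of "k n"] unit_graph_normals_mono[of "1 / real (Suc (k n))" e \<Omega> f x] closure_subset
        by fastforce
    qed
  qed simp
  then have "w \<in> limiting_normals \<Omega> f x" by (simp add: limiting_normals_def)
  moreover have "- 0 \<le> w \<bullet> v"
  proof (rule LIMSEQ_le)
    show "(\<lambda>n. - (1 / real (Suc (k n)))) \<longlonglongrightarrow> - 0" by (intro tendsto_minus inv)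
    show "(\<lambda>n. (u \<circ> k) n \<bullet> v) \<longlonglongrightarrow> w \<bullet> v" by (intro tendsto_intros w)
    show "\<exists>N. \<forall>n\<ge>N. - (1 / real (Suc (k n))) \<le> (u \<circ> k) n \<bullet> v" using u(2) by simp
  qed
  ultimately show ?thesis by auto
qed

lemma sgn_eq_if_norm_1:
  assumes "w = c *\<^sub>R v" "0 \<le> c" "norm w = 1"
  shows "w = v /\<^sub>R norm v"
proof -
  have "c * norm v = 1" using assms by simp
  then have "c = inverse (norm v)" by (metis inverse_unique mult.commute)
  with assms show ?thesis by simp
qed

text \<open>
  The last component of the unit normal $(-G_n, 1)/|(-G_n, 1)|$ is $(1 + |G_n|^2)^{-1/2}$, so
  its limit tells whether the gradients converge or blow up.
\<close>

lemma limiting_normals_subset: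
  fixes f :: "'a::real_inner \<Rightarrow> real"
  shows "limiting_normals \<Omega> f x \<subseteq>
    {\<zeta> /\<^sub>R norm \<zeta> | \<zeta>. \<zeta> \<in> neg_lift (reachable_gradients \<Omega> f x) 1}
    \<union> neg_lift (horizontal_reachable_gradients \<Omega> f x) 0"
proof
  fix w assume w: "w \<in> limiting_normals \<Omega> f x"
  then obtain X G where XG: "gradient_sequence \<Omega> f x X G"
    and lim: "(\<lambda>n. sgn (- G n, 1 :: real)) \<longlonglongrightarrow> w"
    by (rule limiting_normal_sequence)
  have "norm w = 1" using w limiting_normals_subset_sphere by fastforce
  obtain p l where pl: "w = (p, l)" by (cases w)
  define c where "c n = inverse (norm (- G n, 1 :: real))" for n
  have c_pos: "c n > 0" for n by (simp add: c_def zero_prod_def)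
  have sgn: "sgn (- G n, 1 :: real) = (c n *\<^sub>R - G n, c n)" for n
    by (simp add: sgn_div_norm c_def)
  have p: "(\<lambda>n. c n *\<^sub>R - G n) \<longlonglongrightarrow> p" and l: "c \<longlonglongrightarrow> l"
    using tendsto_fst[OF lim] tendsto_snd[OF lim] by (simp_all add: sgn pl)
  have "0 \<le> l" using l c_pos by (intro LIMSEQ_le_const) (auto intro: less_imp_le)
  show "w \<in> {\<zeta> /\<^sub>R norm \<zeta> | \<zeta>. \<zeta> \<in> neg_lift (reachable_gradients \<Omega> f x) 1}
    \<union> neg_lift (horizontal_reachable_gradients \<Omega> f x) 0"
  proof (cases "l = 0")
    case False
    define v where "v = - (inverse l *\<^sub>R p)"
    have "(\<lambda>n. - (inverse (c n) *\<^sub>R (c n *\<^sub>R - G n))) \<longlonglongrightarrow> v"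
      unfolding v_def by (intro tendsto_intros p l False)
    moreover have "- (inverse (c n) *\<^sub>R (c n *\<^sub>R - G n)) = G n" for n
      using c_pos[of n] by simp
    ultimately have "v \<in> reachable_gradients \<Omega> f x"
      using XG by (auto simp: reachable_gradients_def)
    moreover have "w = l *\<^sub>R (- v, 1)" using False by (simp add: pl v_def)
    then have "w = (- v, 1) /\<^sub>R norm (- v, 1 :: real)"
      using \<open>0 \<le> l\<close> \<open>norm w = 1\<close> by (rule sgn_eq_if_norm_1)
    ultimately show ?thesis unfolding neg_lift_def by blast
  next
    case True
    have "norm p = 1" using \<open>norm w = 1\<close> by (simp add: pl True norm_Pair)
    have "filterlim c (at_right 0) sequentially"
      using l c_pos True by (auto simp: filterlim_at intro!: always_eventually simp: less_imp_neq[symmetric])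
    then have inf: "filterlim (\<lambda>n. inverse (c n)) at_top sequentially"
      by (rule filterlim_compose[OF filterlim_inverse_at_top_right])
    \<comment> \<open>\<open>norm (G n)\<close> is written as a factor tending to
      \<open>norm p = 1\<close> times \<open>inverse (c n)\<close>, which tends to infinity.\<close>
    have "filterlim (\<lambda>n. norm (c n *\<^sub>R - G n) * inverse (c n)) at_top sequentially"
      by (rule filterlim_tendsto_pos_mult_at_top[OF tendsto_norm[OF p] _ inf])
        (simp add: \<open>norm p = 1\<close>)
    moreover have "norm (c n *\<^sub>R - G n) * inverse (c n) = norm (G n)" for n
      using c_pos[of n] by simp
    ultimately have "filterlim (\<lambda>n. norm (G n)) at_top sequentially" by (simp only:)
    moreover have "(\<lambda>n. - sgn (c n *\<^sub>R - G n)) \<longlonglongrightarrow> - sgn p"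
      using \<open>norm p = 1\<close> by (intro tendsto_intros p) auto
    then have "(\<lambda>n. G n /\<^sub>R norm (G n)) \<longlonglongrightarrow> (- p) /\<^sub>R norm (- p)"
      using c_pos by (simp add: sgn_scaleR sgn_minus sgn_div_norm[symmetric])
    ultimately have "- p \<in> horizontal_reachable_gradients \<Omega> f x"
      using XG \<open>norm p = 1\<close> unfolding horizontal_reachable_gradients_def by force
    then show ?thesis using True by (force simp: neg_lift_def pl)
  qed
qed

section \<open>Consequences of the exterior sphere condition\<close>

locale exterior_sphere_hypograph =
  fixes \<Omega> :: "'a::euclidean_space set" and f \<rho> :: "'a \<Rightarrow> real"
  assumes open_dom: "open \<Omega>"
    and cont_f: "continuous_on \<Omega> f"
    and cont_\<rho>: "continuous_on \<Omega> \<rho>"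
    and \<rho>_pos: "x \<in> \<Omega> \<Longrightarrow> 0 < \<rho> x"
    and exterior_sphere: "hypo_exterior_sphere \<Omega> f \<rho>"
begin

abbreviation "N x \<equiv> proximal_normals (hypo \<Omega> f) (x, f x)"

lemma isCont_dom: "x \<in> \<Omega> \<Longrightarrow> isCont f x" "x \<in> \<Omega> \<Longrightarrow> isCont \<rho> x"
  using cont_f cont_\<rho> open_dom by (auto simp: continuous_on_eq_continuous_at)

lemma proximal_normal_at_gradient:
  assumes "x \<in> \<Omega>" "GDERIV f x :> G" "v \<in> N x"
  obtains b where "0 \<le> b" "v = b *\<^sub>R (- G, 1)"
proof -
  obtain a b where ab: "v = (a, b)" by (cases v)
  show thesis
    using that[of b] proximal_normal_hypo_parallel[of a b \<Omega> f x f G] assms open_dom ab by simp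
qed

text \<open>Where \<open>f\<close> is differentiable, all proximal normals lie on the ray of
  \<open>(- G, 1)\<close>. The nonzero normal supplied by the exterior sphere condition therefore
  spans this ray, and rescaling keeps its radius.\<close>

lemma graph_normal_realized:
  assumes "x \<in> \<Omega>" "GDERIV f x :> G" "0 \<le> c"
  shows "realized_by_ball (hypo \<Omega> f) (x, f x) (c *\<^sub>R (- G, 1)) (\<rho> x)"
proof -
  obtain v where v: "v \<in> N x" "v \<noteq> 0" "realized_by_ball (hypo \<Omega> f) (x, f x) v (\<rho> x)"
    using exterior_sphere \<open>x \<in> \<Omega>\<close> by (auto simp: hypo_exterior_sphere_def)
  then obtain b where b: "0 \<le> b" "v = b *\<^sub>R (- G, 1)"
    using proximal_normal_at_gradient[OF assms(1,2)] by metis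
  then have "b \<noteq> 0" using v(2) by (metis scaleR_zero_left)
  then have "c *\<^sub>R (- G, 1) = (c / b) *\<^sub>R v" by (simp add: b(2))
  then show ?thesis using realized_by_ball_scaleR[OF v(3), of "c / b"] assms(3) b(1) by simp
qed

text \<open>By continuity the radii at \<open>X n\<close> tend to \<open>\<rho> x > 0\<close>, so
  \<open>realized_by_ball_limit\<close> applies. The free factors \<open>c n\<close> serve the three
  scalings needed below: unit normals, last component 1, and first component tending to a horizontal
  limit.\<close>

lemma graph_normals_limit:
  assumes "x \<in> \<Omega>" "gradient_sequence \<Omega> f x X G" "\<And>n. 0 \<le> c n"
    and "(\<lambda>n. c n *\<^sub>R (- G n, 1)) \<longlonglongrightarrow> w"
  shows "w \<in> N x"
proof (rule realized_by_ball_imp_proximal_normal[OF realized_by_ball_limit])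
  have X: "X \<longlonglongrightarrow> x" "\<And>n. X n \<in> \<Omega>" "\<And>n. GDERIV f (X n) :> G n"
    using assms(2) by (auto simp: gradient_sequence_def)
  then show "realized_by_ball (hypo \<Omega> f) (X n, f (X n)) (c n *\<^sub>R (- G n, 1)) (\<rho> (X n))" for n
    using assms(3) by (intro graph_normal_realized)
  show "(\<lambda>n. (X n, f (X n))) \<longlonglongrightarrow> (x, f x)"
    using X assms(1) by (intro tendsto_intros isCont_tendsto_compose[OF isCont_dom(1)])
  show "(\<lambda>n. \<rho> (X n)) \<longlonglongrightarrow> \<rho> x"
    using X assms(1) by (intro isCont_tendsto_compose[OF isCont_dom(2)])
qed (use assms \<rho>_pos in force)+

lemma limiting_normals_proximal:
  assumes "x \<in> \<Omega>"
  shows "limiting_normals \<Omega> f x \<subseteq> N x"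
proof
  fix w assume "w \<in> limiting_normals \<Omega> f x"
  then obtain X G where "gradient_sequence \<Omega> f x X G" "(\<lambda>n. sgn (- G n, 1 :: real)) \<longlonglongrightarrow> w"
    by (rule limiting_normal_sequence)
  then show "w \<in> N x"
    using assms by (intro graph_normals_limit[where c = "\<lambda>n. inverse (norm (- G n, 1 :: real))"])
      (auto simp: sgn_div_norm)
qed

lemma reachable_gradients_proximal:
  assumes "x \<in> \<Omega>"
  shows "neg_lift (reachable_gradients \<Omega> f x) 1 \<subseteq> N x"
proof -
  have "(- v, 1) \<in> N x" if "gradient_sequence \<Omega> f x X G" "G \<longlonglongrightarrow> v" for v X G
    using assms that
    by (intro graph_normals_limit[where c = "\<lambda>_. 1"]) (auto intro!: tendsto_intros)
  then show ?thesis by (auto simp: neg_lift_def reachable_gradients_def)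
qed

lemma horizontal_reachable_gradients_proximal:
  assumes "x \<in> \<Omega>"
  shows "neg_lift (horizontal_reachable_gradients \<Omega> f x) 0 \<subseteq> N x"
proof -
  have "(- v, 0) \<in> N x"
    if "v \<noteq> 0" "gradient_sequence \<Omega> f x X G" "(\<lambda>n. G n /\<^sub>R norm (G n)) \<longlonglongrightarrow> v /\<^sub>R norm v"
      "filterlim (\<lambda>n. norm (G n)) at_top sequentially" for v X G
  proof (rule graph_normals_limit[OF assms that(2)])
    \<comment> \<open>With the factor \<open>norm v / norm (G n)\<close> the first components tend
      to \<open>- v\<close>, while the last ones tend to 0.\<close>
    have "(\<lambda>n. norm v *\<^sub>R - (G n /\<^sub>R norm (G n))) \<longlonglongrightarrow> norm v *\<^sub>R - (v /\<^sub>R norm v)"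
      by (intro tendsto_intros that)
    moreover have "(\<lambda>n. norm v * inverse (norm (G n))) \<longlonglongrightarrow> norm v * 0"
      by (intro tendsto_intros tendsto_inverse_0_at_top that)
    ultimately have "(\<lambda>n. (norm v *\<^sub>R - (G n /\<^sub>R norm (G n)), norm v * inverse (norm (G n))))
        \<longlonglongrightarrow> (norm v *\<^sub>R - (v /\<^sub>R norm v), norm v * 0)"
      by (rule tendsto_Pair)
    then show "(\<lambda>n. (norm v * inverse (norm (G n))) *\<^sub>R (- G n, 1)) \<longlonglongrightarrow> (- v, 0 :: real)"
      using \<open>v \<noteq> 0\<close> by simp
  qed simp
  then show ?thesis by (auto simp: neg_lift_def horizontal_reachable_gradients_def)
qed

text \<open>At the point found by \<open>mean_value_lower_slope\<close> a paraboloid touches from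
  below and the exterior sphere condition supplies a nonzero normal, so the slope found there is the
  gradient.\<close>

lemma gradient_mean_value:
  assumes R: "cball c R \<subseteq> \<Omega>" and "a \<in> ball c R" "b \<in> ball c R" "r < f b - f a"
  obtains x G where "x \<in> ball c R" "GDERIV f x :> G" "r \<le> G \<bullet> (b - a)"
proof -
  have "continuous_on (cball c R) f" using cont_f R by (rule continuous_on_subset)
  then obtain x z M where x: "x \<in> ball c R" "r \<le> z \<bullet> (b - a)"
    and below: "\<And>y. y \<in> cball c R \<Longrightarrow> f x + z \<bullet> (y - x) - M * (norm (y - x))\<^sup>2 \<le> f y"
    using mean_value_lower_slope assms(2-) by metis
  have "x \<in> \<Omega>" using x R by auto
  then obtain v where "v \<in> N x" "v \<noteq> 0"
    using exterior_sphere by (auto simp: hypo_exterior_sphere_def)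
  moreover have "\<forall>\<^sub>F y in nhds x. y \<in> ball c R"
    using x(1) by (intro eventually_nhds_in_open) auto
  then have "\<forall>\<^sub>F y in nhds x. f x + z \<bullet> (y - x) - M * (norm (y - x))\<^sup>2 \<le> f y"
    by eventually_elim (use below in auto)
  ultimately have "GDERIV f x :> z"
    using \<open>x \<in> \<Omega>\<close> open_dom isCont_dom by (intro GDERIV_if_touched_below)
  with x that show thesis by blast
qed

lemma limiting_normals_nonempty:
  assumes "x \<in> \<Omega>"
  shows "limiting_normals \<Omega> f x \<noteq> {}"
proof -
  have "\<exists>u\<in>unit_graph_normals \<Omega> f x e. - e \<le> u \<bullet> 0" if "e > 0" for e
  proof -
    define W where "W = \<Omega> \<inter> ball x e"
    have "open W" "x \<in> W" using open_dom assms that by (auto simp: W_def)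
    then have "W \<noteq> {x}" using not_open_singleton by metis
    then obtain y where "y \<in> W - {x}" using \<open>x \<in> W\<close> by blast
    moreover have "open (W - {x})" using \<open>open W\<close> by (rule open_delete)
    ultimately obtain R where "R > 0" and R: "cball y R \<subseteq> W - {x}"
      by (meson open_contains_cball)
    have "cball y R \<subseteq> \<Omega>" using R by (auto simp: W_def)
    \<comment> \<open>With both endpoints at \<open>y\<close> and \<open>r = -1\<close> the mean
      value hypothesis holds trivially. All that is wanted is some point of differentiability in a
      ball that avoids \<open>x\<close>.\<close>
    then obtain X G where "X \<in> ball y R" "GDERIV f X :> G"
      using \<open>R > 0\<close> gradient_mean_value[of y R y y "-1"] by (metis centre_in_ball diff_self neg_less_0_iff_less zero_less_one)
    moreover from this R have "X \<in> W - {x}" by (meson ball_subset_cball subsetD)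
    ultimately have "sgn (- G, 1) \<in> unit_graph_normals \<Omega> f x e"
      by (auto simp: unit_graph_normals_def W_def dist_commute)
    then show ?thesis using that by (intro bexI) auto
  qed
  then show ?thesis using limiting_normal_exists[of \<Omega> f x 0] by auto
qed

text \<open>
  Since $\nu \cdot v \ge 0$, the point $(x, f(x)) + t (v + t K \nu)$ lies in the ball realizing
  $\nu$ and hence above the graph, for $K$ large and $t$ small. The mean value inequality on the
  segment from its projection back to $x$ yields a gradient whose normal has almost nonnegative
  product with $v$.
\<close>

lemma limiting_normal_in_direction:
  assumes "x \<in> \<Omega>" and \<nu>: "\<nu> \<in> N x" "\<nu> \<noteq> 0" "0 \<le> \<nu> \<bullet> v"
  shows "\<exists>w\<in>limiting_normals \<Omega> f x. 0 \<le> w \<bullet> v"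
\<comment> \<open>Limiting normals ignore \<open>x\<close> itself. If \<open>f\<close> is
  differentiable there, \<nu> and every limiting normal are nonnegative multiples of the same vector
  \<open>(- G, 1)\<close>, so any limiting normal works. Otherwise the point of differentiability
  found below is automatically different from \<open>x\<close>.\<close>
proof (cases "\<exists>G. GDERIV f x :> G")
  case True
  then obtain G where G: "GDERIV f x :> G" by blast
  obtain w where w: "w \<in> limiting_normals \<Omega> f x"
    using limiting_normals_nonempty[OF \<open>x \<in> \<Omega>\<close>] by blast
  then have "w \<in> N x" using limiting_normals_proximal[OF \<open>x \<in> \<Omega>\<close>] by blast
  then obtain c where c: "0 \<le> c" "w = c *\<^sub>R (- G, 1)"
    using proximal_normal_at_gradient[OF \<open>x \<in> \<Omega>\<close> G] by metis
  obtain b where b: "0 \<le> b" "\<nu> = b *\<^sub>R (- G, 1)"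
    using proximal_normal_at_gradient[OF \<open>x \<in> \<Omega>\<close> G \<nu>(1)] by metis
  have "0 < b" using b \<nu>(2) by (metis less_eq_real_def scaleR_zero_left)
  moreover have "0 \<le> b * ((- G, 1) \<bullet> v)" using \<nu>(3) by (simp add: b(2) del: scaleR_Pair)
  ultimately have "0 \<le> (- G, 1) \<bullet> v" by (simp add: zero_le_mult_iff)
  then have "0 \<le> w \<bullet> v" using c by (simp del: scaleR_Pair)
  with w show ?thesis by blast
next
  case False
  obtain s where "s \<ge> 0"
    and s: "\<forall>y\<in>hypo \<Omega> f. \<nu> \<bullet> (y - (x, f x)) \<le> s * (norm (y - (x, f x)))\<^sup>2"
    using \<nu>(1) by (auto simp: proximal_normals_def)
  \<comment> \<open>\<open>K * (norm \<nu>)\<^sup>2\<close> exceeds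
    \<open>s * (norm v)\<^sup>2\<close> by 1. At order \<open>t\<^sup>2\<close>, the tilt towards
    \<nu> thus gains more than the normal inequality allows.\<close>
  define K where "K = (s * (norm v)\<^sup>2 + 1) / (norm \<nu>)\<^sup>2"
  have "K > 0" using \<open>s \<ge> 0\<close> \<nu>(2) by (auto simp: K_def intro!: divide_pos_pos add_nonneg_pos)
  define V where "V t = v + (t * K) *\<^sub>R \<nu>" for t
  have V0: "(V \<longlongrightarrow> v) (at_right 0)"
    unfolding V_def by (auto intro!: tendsto_eq_intros)
  have "((\<lambda>t. s * (norm (V t))\<^sup>2) \<longlongrightarrow> s * (norm v)\<^sup>2) (at_right 0)"
    by (intro tendsto_intros V0)
  moreover have "s * (norm v)\<^sup>2 < K * (norm \<nu>)\<^sup>2" using \<nu>(2) by (simp add: K_def)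
  ultimately have ev1: "\<forall>\<^sub>F t in at_right 0. s * (norm (V t))\<^sup>2 < K * (norm \<nu>)\<^sup>2"
    by (rule order_tendstoD)
  have lim_q: "((\<lambda>t. x + t *\<^sub>R fst (V t)) \<longlongrightarrow> x) (at_right 0)"
    using tendsto_add[OF tendsto_const[of x] tendsto_scaleR[OF tendsto_ident_at tendsto_fst[OF V0]]]
    by simp
  have "\<exists>u\<in>unit_graph_normals \<Omega> f x e. - e \<le> u \<bullet> v" if "e > 0" for e
  proof -
    have "open (\<Omega> \<inter> ball x e)" "x \<in> \<Omega> \<inter> ball x e" using open_dom assms(1) that by auto
    then obtain R where "R > 0" and R: "cball x R \<subseteq> \<Omega> \<inter> ball x e"
      by (meson open_contains_cball)
    have "((\<lambda>t. t * K * norm \<nu>) \<longlongrightarrow> 0) (at_right 0)" by (auto intro!: tendsto_eq_intros)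
    then have ev2: "\<forall>\<^sub>F t in at_right 0. t * K * norm \<nu> < e" using that by (rule order_tendstoD)
    have ev3: "\<forall>\<^sub>F t in at_right 0. x + t *\<^sub>R fst (V t) \<in> ball x R"
      using \<open>R > 0\<close> by (intro topological_tendstoD[OF lim_q]) auto
    have ev: "\<forall>\<^sub>F t in at_right 0. (0::real) < t \<and> s * (norm (V t))\<^sup>2 < K * (norm \<nu>)\<^sup>2
        \<and> t * K * norm \<nu> < e \<and> x + t *\<^sub>R fst (V t) \<in> ball x R"
      using ev1 ev2 ev3 eventually_at_right_less[of 0] by eventually_elim auto
    then obtain t where t: "0 < t" "s * (norm (V t))\<^sup>2 < K * (norm \<nu>)\<^sup>2"
        "t * K * norm \<nu> < e" "x + t *\<^sub>R fst (V t) \<in> ball x R"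
      using eventually_happens'[OF trivial_limit_at_right_real ev] by auto
    define q where "q = x + t *\<^sub>R fst (V t)"
    \<comment> \<open>Otherwise \<open>(x, f x) + t *\<^sub>R V t\<close> would lie in the
      hypograph, and the normal inequality would push \<open>\<nu> \<bullet> V t\<close> below
      \<open>t * (K * (norm \<nu>)\<^sup>2)\<close>, contrary to
      \<open>0 \<le> \<nu> \<bullet> v\<close>.\<close>
    have "f q < f x + t * snd (V t)"
    proof (rule ccontr)
      assume "\<not> ?thesis"
      moreover have "q \<in> \<Omega>" using t(4) R by (auto simp: q_def)
      ultimately have "(x, f x) + t *\<^sub>R V t \<in> hypo \<Omega> f"
        by (cases "V t") (auto simp: hypo_def q_def)
      from s[rule_format, OF this] have "t * (\<nu> \<bullet> V t) \<le> t * (s * t * (norm (V t))\<^sup>2)"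
        by (simp add: power_mult_distrib power2_eq_square mult_ac)
      then have "\<nu> \<bullet> V t \<le> t * (s * (norm (V t))\<^sup>2)" using t(1) by (simp add: mult_ac)
      also have "\<dots> < t * (K * (norm \<nu>)\<^sup>2)" using t by (intro mult_strict_left_mono)
      also have "\<dots> \<le> \<nu> \<bullet> V t"
        using \<nu>(3) by (simp add: V_def inner_add_right power2_norm_eq_inner mult_ac)
      finally show False by simp
    qed
    then have "- (t * snd (V t)) < f x - f q" by simp
    then obtain X G where X: "X \<in> ball x R" "GDERIV f X :> G" "- (t * snd (V t)) \<le> G \<bullet> (x - q)"
      using gradient_mean_value[of x R q x "- (t * snd (V t))"] t(4) R \<open>R > 0\<close>
      unfolding q_def by auto
    have "X \<noteq> x" using X(2) False by auto
    moreover have "X \<in> \<Omega> \<inter> ball x e" using X(1) R by (meson ball_subset_cball subsetD)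
    ultimately have u: "sgn (- G, 1) \<in> unit_graph_normals \<Omega> f x e"
      using X(2) by (auto simp: unit_graph_normals_def dist_commute)
    have "0 \<le> t * ((- G, 1) \<bullet> V t)"
      using X(3) by (cases "V t") (simp add: q_def right_diff_distrib)
    then have "0 \<le> (- G, 1) \<bullet> V t" using t(1) by (simp add: zero_le_mult_iff)
    then have "0 \<le> sgn (- G, 1) \<bullet> V t" by (simp add: sgn_div_norm del: scaleR_Pair)
    \<comment> \<open>Passing from \<open>V t\<close> back to \<open>v\<close> lowers the product by
      at most \<open>t * K * norm \<nu>\<close>, which is below \<open>e\<close>.\<close>
    moreover have "sgn (- G, 1) \<bullet> \<nu> \<le> norm \<nu>"
      using norm_cauchy_schwarz[of "sgn (- G, 1)" \<nu>] norm_unit_graph_normal[OF u] by simp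
    then have "(t * K) * (sgn (- G, 1) \<bullet> \<nu>) \<le> (t * K) * norm \<nu>"
      using t(1) \<open>K > 0\<close> by (intro mult_left_mono) auto
    ultimately have "- e \<le> sgn (- G, 1) \<bullet> v"
      using t(3) by (simp add: V_def inner_add_right del: inner_Pair)
    with u show ?thesis by blast
  qed
  then show ?thesis by (rule limiting_normal_exists)
qed

section \<open>Exposed rays and pointed normal cones\<close>

text \<open>\<nu> is orthogonal to the exposing direction \<open>v\<close>, so some limiting normal
  \<open>w\<close> has \<open>0 \<le> w \<bullet> v\<close>. Exposure puts \<open>w\<close> on the
  ray of \<nu>, which contains only one unit vector.\<close>

lemma exposed_unit_vector_is_limiting_normal:
  assumes "x \<in> \<Omega>" "C \<subseteq> N x" "limiting_normals \<Omega> f x \<subseteq> C"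
    and "exposed_ray R C" "\<nu> \<in> R" "norm \<nu> = 1"
  shows "\<nu> \<in> limiting_normals \<Omega> f x"
proof -
  obtain \<zeta> v where R: "R = half_line \<zeta>" "R \<subseteq> C" "\<zeta> \<bullet> v = 0"
    and exposed: "\<And>w. w \<in> C - (R \<union> {0}) \<Longrightarrow> w \<bullet> v < 0"
    using assms(4) unfolding exposed_ray_def by blast
  obtain t where t: "0 \<le> t" "\<nu> = t *\<^sub>R \<zeta>"
    using assms(5) R(1) by (auto simp: half_line_def)
  then have "\<nu> \<bullet> v = 0" using R(3) by simp
  moreover have "\<nu> \<in> N x" "\<nu> \<noteq> 0" using R(2) assms by auto
  ultimately obtain w where w: "w \<in> limiting_normals \<Omega> f x" "0 \<le> w \<bullet> v"
    using limiting_normal_in_direction[OF assms(1), of \<nu> v] by auto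
  have "norm w = 1" using w(1) limiting_normals_subset_sphere by fastforce
  then have "w \<noteq> 0" by auto
  moreover have "w \<in> C" using w(1) assms(3) by blast
  ultimately have "w \<in> R" using w(2) exposed[of w] by (meson DiffI Un_iff empty_iff insert_iff not_le)
  then obtain r where "0 \<le> r" "w = r *\<^sub>R \<zeta>" using R(1) by (auto simp: half_line_def)
  then have "w = \<zeta> /\<^sub>R norm \<zeta>" using sgn_eq_if_norm_1 \<open>norm w = 1\<close> by blast
  moreover have "\<nu> = \<zeta> /\<^sub>R norm \<zeta>" using sgn_eq_if_norm_1 t \<open>norm \<nu> = 1\<close> by blast
  ultimately have "w = \<nu>" by (simp only:)
  with w show ?thesis by simp
qed

text \<open>Pointedness makes \<open>N x - {0}\<close> convex: a vanishing convex combination of two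
  nonzero normals would produce a nonzero normal whose negative is also a normal. The limiting
  normals lie in this convex set.\<close>

lemma zero_notin_convex_hull_limiting_normals:
  assumes "x \<in> \<Omega>" "pointed (N x)"
  shows "0 \<notin> convex hull limiting_normals \<Omega> f x"
proof -
  have "convex (N x - {0})"
    unfolding convex_def
  proof (intro ballI allI impI)
    fix y z and u v :: real
    assume yz: "y \<in> N x - {0}" "z \<in> N x - {0}" and uv: "0 \<le> u" "0 \<le> v" "u + v = 1"
    have mem: "u *\<^sub>R y \<in> N x" "v *\<^sub>R z \<in> N x"
      using yz uv by (auto intro: proximal_normals_scaleR)
    have "u *\<^sub>R y + v *\<^sub>R z \<noteq> 0"
    proof
      assume "u *\<^sub>R y + v *\<^sub>R z = 0"
      then have eq: "u *\<^sub>R y = - (v *\<^sub>R z)" by (simp add: eq_neg_iff_add_eq_0)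
      then have "u *\<^sub>R y \<in> N x \<inter> uminus ` N x" using mem by (metis IntI image_eqI)
      then have "u *\<^sub>R y = 0" using assms(2) unfolding pointed_def by blast
      moreover from this have "v *\<^sub>R z = 0" using eq by simp
      ultimately have "u = 0" "v = 0" using yz by auto
      then show False using uv by simp
    qed
    then show "u *\<^sub>R y + v *\<^sub>R z \<in> N x - {0}" using mem by (simp add: proximal_normals_add)
  qed
  moreover have "limiting_normals \<Omega> f x \<subseteq> N x - {0}"
    using limiting_normals_proximal[OF assms(1)] limiting_normals_subset_sphere[of \<Omega> f x] by auto
  ultimately have "convex hull limiting_normals \<Omega> f x \<subseteq> N x - {0}" by (intro hull_minimal)
  then show ?thesis by blast
qed

text \<open>
  If a proximal normal $\nu$ were outside the cone, a hyperplane would separate its half line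
  from the compact convex hull: a vector $v$ with $\nu \cdot v \ge 0$ and $w \cdot v < 0$ for all
  limiting normals $w$.
\<close>

lemma proximal_normals_eq_conic_hull:
  assumes "x \<in> \<Omega>" "pointed (N x)"
  shows "N x = conic hull (convex hull limiting_normals \<Omega> f x)"
proof
  let ?T = "convex hull limiting_normals \<Omega> f x"
  have "?T \<subseteq> N x"
    using limiting_normals_proximal[OF assms(1)] convex_proximal_normals by (intro hull_minimal)
  then show "conic hull ?T \<subseteq> N x"
    unfolding conic_hull_explicit by (blast intro: proximal_normals_scaleR)
  show "N x \<subseteq> conic hull ?T"
  proof (rule ccontr)
    assume "\<not> N x \<subseteq> conic hull ?T"
    then obtain \<nu> where \<nu>: "\<nu> \<in> N x" "\<nu> \<notin> conic hull ?T" by blast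
    have "?T \<noteq> {}" using limiting_normals_nonempty[OF assms(1)] by simp
    then obtain w where "w \<in> ?T" by blast
    then have "0 *\<^sub>R w \<in> conic hull ?T" unfolding conic_hull_explicit by blast
    then have "\<nu> \<noteq> 0" using \<nu> by auto
    \<comment> \<open>A multiple \<open>c *\<^sub>R \<nu>\<close> in the hull has
      \<open>c \<noteq> 0\<close>, since the hull misses the origin; dividing by \<open>c\<close>
      would put \<nu> into the conic hull.\<close>
    have "?T \<inter> conic hull {\<nu>} = {}"
    proof (rule ccontr)
      assume "?T \<inter> conic hull {\<nu>} \<noteq> {}"
      then obtain c where c: "0 \<le> c" "c *\<^sub>R \<nu> \<in> ?T" by (auto simp: conic_hull_explicit)
      moreover have "c \<noteq> 0" using c zero_notin_convex_hull_limiting_normals[OF assms] by auto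
      then have "\<nu> = inverse c *\<^sub>R (c *\<^sub>R \<nu>)" by simp
      ultimately have "\<nu> \<in> conic hull ?T"
        unfolding conic_hull_explicit by (metis (mono_tags, lifting) inverse_nonnegative_iff_nonnegative mem_Collect_eq)
      then show False using \<nu> by simp
    qed
    moreover have "convex (conic hull {\<nu>})" by (simp add: convex_conic_hull)
    moreover have "closed (conic hull {\<nu>})" using \<open>\<nu> \<noteq> 0\<close> by (intro closed_conic_hull) auto
    moreover have "compact ?T" by (rule compact_convex_hull[OF compact_limiting_normals])
    ultimately obtain v b
      where v: "\<And>w. w \<in> ?T \<Longrightarrow> v \<bullet> w < b" "\<And>y. y \<in> conic hull {\<nu>} \<Longrightarrow> b < v \<bullet> y"
      using separating_hyperplane_compact_closed[OF convex_convex_hull _ \<open>?T \<noteq> {}\<close>] by metis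
    \<comment> \<open>The case \<open>c = 0\<close> gives \<open>b < 0\<close>. If
      \<open>v \<bullet> \<nu>\<close> were negative, \<open>c = b / (v \<bullet> \<nu>)\<close>
      would give \<open>b < b\<close>.\<close>
    have ray: "b < c * (v \<bullet> \<nu>)" if "0 \<le> c" for c
    proof -
      have "c *\<^sub>R \<nu> \<in> conic hull {\<nu>}" using that unfolding conic_hull_explicit by blast
      then show ?thesis using v(2)[of "c *\<^sub>R \<nu>"] by simp
    qed
    have "b < 0" using ray[of 0] by simp
    have "0 \<le> \<nu> \<bullet> v"
    proof (rule ccontr)
      assume "\<not> ?thesis"
      then have "v \<bullet> \<nu> < 0" by (simp add: inner_commute)
      then show False using ray[of "b / (v \<bullet> \<nu>)"] \<open>b < 0\<close> by (simp add: divide_nonpos_neg)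
    qed
    then obtain w where "w \<in> limiting_normals \<Omega> f x" "0 \<le> w \<bullet> v"
      using limiting_normal_in_direction[OF assms(1) \<nu>(1) \<open>\<nu> \<noteq> 0\<close>] by blast
    moreover from this have "w \<bullet> v < b" using v(1)[of w] by (simp add: hull_inc inner_commute)
    ultimately show False using \<open>b < 0\<close> by simp
  qed
qed

text \<open>The conic hull of a compact set that avoids the origin is closed.\<close>

lemma closed_proximal_normals:
  assumes "x \<in> \<Omega>" "pointed (N x)"
  shows "closed (N x)"
  unfolding proximal_normals_eq_conic_hull[OF assms]
  using zero_notin_convex_hull_limiting_normals[OF assms]
    compact_convex_hull[OF compact_limiting_normals] by (intro closed_conic_hull) blast

text \<open>The multiples on the right form a cone containing all limiting normals. Its convex hull
  is again a cone, so it contains the conic hull of the convex hull of the limiting normals.\<close>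

lemma proximal_normals_eq_convex_hull:
  assumes "x \<in> \<Omega>" "pointed (N x)"
  shows "N x = convex hull {l *\<^sub>R v | l v. 0 \<le> l \<and>
           v \<in> neg_lift (horizontal_reachable_gradients \<Omega> f x) 0
               \<union> neg_lift (reachable_gradients \<Omega> f x) 1}" (is "_ = convex hull ?K")
proof
  have "?K \<subseteq> N x"
    using reachable_gradients_proximal[OF assms(1)] horizontal_reachable_gradients_proximal[OF assms(1)]
    by (blast intro: proximal_normals_scaleR)
  then show "convex hull ?K \<subseteq> N x" by (intro hull_minimal convex_proximal_normals)
  have "c *\<^sub>R (l *\<^sub>R v) \<in> ?K" if "0 \<le> c" "0 \<le> l" "v \<in> neg_lift (horizontal_reachable_gradients \<Omega> f x) 0
      \<union> neg_lift (reachable_gradients \<Omega> f x) 1" for c l v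
    using that by (intro CollectI exI[of _ "c * l"] exI[of _ v] conjI) auto
  then have "cone ?K" unfolding cone_def by blast
  then have "cone (convex hull ?K)" by (rule cone_convex_hull)
  have "limiting_normals \<Omega> f x \<subseteq> ?K"
  proof
    fix w assume "w \<in> limiting_normals \<Omega> f x"
    then have "w \<in> {\<zeta> /\<^sub>R norm \<zeta> | \<zeta>. \<zeta> \<in> neg_lift (reachable_gradients \<Omega> f x) 1}
      \<union> neg_lift (horizontal_reachable_gradients \<Omega> f x) 0"
      using limiting_normals_subset by blast
    then show "w \<in> ?K"
    proof
      assume "w \<in> {\<zeta> /\<^sub>R norm \<zeta> | \<zeta>. \<zeta> \<in> neg_lift (reachable_gradients \<Omega> f x) 1}"
      then show ?thesis using inverse_nonnegative_iff_nonnegative norm_ge_zero by blast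
    next
      assume "w \<in> neg_lift (horizontal_reachable_gradients \<Omega> f x) 0"
      then show ?thesis by (intro CollectI exI[of _ 1] exI[of _ w]) simp
    qed
  qed
  then have "convex hull limiting_normals \<Omega> f x \<subseteq> convex hull ?K" by (rule hull_mono)
  then show "N x \<subseteq> convex hull ?K"
    unfolding proximal_normals_eq_conic_hull[OF assms] conic_hull_explicit
    using mem_cone[OF \<open>cone (convex hull ?K)\<close>] by blast
qed

lemma convex_horizontal_superdiff: "convex (horizontal_superdiff \<Omega> f x)"
proof -
  have "linear (\<lambda>v::'a. (- v, 0 :: real))" by (auto intro!: linearI)
  moreover have "horizontal_superdiff \<Omega> f x = (\<lambda>v. (- v, 0)) -` N x"
    by (auto simp: horizontal_superdiff_def)
  ultimately show ?thesis using convex_linear_vimage convex_proximal_normals by metis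
qed

lemma convex_proximal_superdiff: "convex (proximal_superdiff \<Omega> f x)"
proof -
  have "(- (u *\<^sub>R a + v *\<^sub>R b), 1) \<in> N x"
    if "(- a, 1) \<in> N x" "(- b, 1) \<in> N x" "0 \<le> u" "0 \<le> v" "u + v = 1" for a b and u v :: real
    using convexD[OF convex_proximal_normals that] that(5) by simp
  then show ?thesis by (simp add: convex_def proximal_superdiff_def)
qed

end

section \<open>Slices of the normal cone: the two superdifferentials\<close>

lemma cone_horizontal_reachable_gradients:
  "cone (horizontal_reachable_gradients \<Omega> f x \<union> {0})"
proof -
  have "c *\<^sub>R v \<in> horizontal_reachable_gradients \<Omega> f x"
    if "v \<in> horizontal_reachable_gradients \<Omega> f x" "0 < c" for v c
  proof -
    have eq: "(c *\<^sub>R v) /\<^sub>R norm (c *\<^sub>R v) = v /\<^sub>R norm v"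
      using \<open>0 < c\<close> sgn_scaleR[of c v] by (simp add: sgn_div_norm)
    show ?thesis
      using that unfolding horizontal_reachable_gradients_def mem_Collect_eq eq by auto
  qed
  then show ?thesis by (auto simp: cone_def order_le_less)
qed

text \<open>The last component \<open>c\<close> is the total weight placed on \<open>A\<close>. For
  \<open>c > 0\<close>, dividing these weights by \<open>c\<close> gives a convex combination of
  \<open>A\<close>; the remaining part stays in the hull of \<open>B \<union> {0}\<close>, which is
  a convex cone. It is applied at \<open>c = 0\<close> and \<open>c = 1\<close>.\<close>

lemma convex_cone_hull_split:
  fixes A B :: "'a::real_vector set"
  assumes "cone (B \<union> {0})"
    and "y \<in> convex hull {l *\<^sub>R v | l v. 0 \<le> l \<and> v \<in> neg_lift B 0 \<union> neg_lift A 1}"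
  obtains u c where "y = (- u, c :: real)" "c = 0 \<and> u \<in> convex hull (B \<union> {0}) \<or>
    0 < c \<and> (\<exists>a\<in>convex hull A. \<exists>d\<in>convex hull (B \<union> {0}). u = c *\<^sub>R a + d)"
proof -
  let ?D = "convex hull (B \<union> {0})"
  \<comment> \<open>\<open>P\<close> is preserved by nonnegative multiples and by sums, so it
    describes a convex set containing the generators. Height 0 is a separate case because
    \<open>A\<close> may be empty.\<close>
  define P where "P u c \<longleftrightarrow> c = 0 \<and> u \<in> ?D \<or> 0 < c \<and> (\<exists>a\<in>convex hull A. \<exists>d\<in>?D. u = c *\<^sub>R a + d)"
    for u and c :: real
  have scale_D: "t *\<^sub>R d \<in> ?D" if "d \<in> ?D" "0 \<le> t" for d and t :: real
    using cone_convex_hull[OF assms(1)] that by (simp add: cone_def)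
  have add_D: "d + e \<in> ?D" if "d \<in> ?D" "e \<in> ?D" for d e
    using convex_cone[of ?D] cone_convex_hull[OF assms(1)] that by simp
  have zero_D: "0 \<in> ?D" by (simp add: hull_inc)
  have scale: "P (t *\<^sub>R u) (t * c)" if "P u c" "0 \<le> t" for u c t
  proof (cases "t = 0 \<or> c = 0")
    case True
    then show ?thesis using that zero_D scale_D by (auto simp: P_def)
  next
    case False
    then obtain a d where "0 < c" "a \<in> convex hull A" "d \<in> ?D" "u = c *\<^sub>R a + d"
      using \<open>P u c\<close> unfolding P_def by blast
    moreover from this have "t *\<^sub>R u = (t * c) *\<^sub>R a + t *\<^sub>R d" by (simp add: scaleR_add_right)
    ultimately show ?thesis using False that scale_D by (auto simp: P_def)
  qed
  have add_0: "P (u + u') c'" if "P u 0" "P u' c'" for u u' c'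
  proof (cases "c' = 0")
    case True
    then show ?thesis using that add_D by (simp add: P_def)
  next
    case False
    then obtain a d where "0 < c'" "a \<in> convex hull A" "d \<in> ?D" "u' = c' *\<^sub>R a + d"
      using \<open>P u' c'\<close> unfolding P_def by blast
    moreover from this have "u + u' = c' *\<^sub>R a + (u + d)" by simp
    moreover have "u + d \<in> ?D" using that \<open>d \<in> ?D\<close> add_D by (simp add: P_def)
    ultimately show ?thesis unfolding P_def by blast
  qed
  have add: "P (u + u') (c + c')" if "P u c" "P u' c'" for u u' c c'
  proof (cases "c = 0 \<or> c' = 0")
    case True
    then show ?thesis using add_0[of u u' c'] add_0[of u' u c] that by (auto simp: add.commute)
  next
    case False
    then obtain a d a' d' where *: "0 < c" "a \<in> convex hull A" "d \<in> ?D" "u = c *\<^sub>R a + d"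
      "0 < c'" "a' \<in> convex hull A" "d' \<in> ?D" "u' = c' *\<^sub>R a' + d'"
      using \<open>P u c\<close> \<open>P u' c'\<close> unfolding P_def by blast
    \<comment> \<open>The two points of the hull of \<open>A\<close> are averaged with weights
      proportional to their heights.\<close>
    define a'' where "a'' = (c / (c + c')) *\<^sub>R a + (c' / (c + c')) *\<^sub>R a'"
    have "a'' \<in> convex hull A"
      unfolding a''_def using * by (intro convexD[OF convex_convex_hull]) (auto simp: add_divide_distrib[symmetric])
    moreover have "u + u' = (c + c') *\<^sub>R a'' + (d + d')"
      using * by (simp add: a''_def scaleR_add_right)
    moreover have "d + d' \<in> ?D" "0 < c + c'" using * add_D by auto
    ultimately show ?thesis unfolding P_def by blast
  qed
  have "convex {(- u, c) | u c. P u c}"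
    unfolding convex_def
  proof clarify
    fix s t :: real and u c u' c'
    assume st: "0 \<le> s" "0 \<le> t" and P: "P u c" "P u' c'"
    have "P (s *\<^sub>R u + t *\<^sub>R u') (s * c + t * c')" using st P by (intro add scale)
    then show "\<exists>v d. s *\<^sub>R (- u, c) + t *\<^sub>R (- u', c') = (- v, d) \<and> P v d"
      by (intro exI[of _ "s *\<^sub>R u + t *\<^sub>R u'"] exI[of _ "s * c + t * c'"]) simp
  qed
  moreover have "{l *\<^sub>R v | l v. 0 \<le> l \<and> v \<in> neg_lift B 0 \<union> neg_lift A 1} \<subseteq> {(- u, c) | u c. P u c}"
  proof
    fix y :: "'a \<times> real"
    assume "y \<in> {l *\<^sub>R v | l v. 0 \<le> l \<and> v \<in> neg_lift B 0 \<union> neg_lift A 1}"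
    then obtain l :: real and a b where l: "0 \<le> l"
      and v: "(a, b) \<in> neg_lift B 0 \<union> neg_lift A 1" and y: "y = l *\<^sub>R (a, b)"
      by auto
    have "P (- a) b"
      using v
    proof
      assume "(a, b) \<in> neg_lift B 0"
      then show ?thesis by (auto simp: neg_lift_def P_def hull_inc)
    next
      assume "(a, b) \<in> neg_lift A 1"
      then have "b = 1" "- a \<in> A" by (auto simp: neg_lift_def)
      moreover from this have "- a \<in> convex hull A" "- a = b *\<^sub>R - a + 0" by (auto simp: hull_inc)
      ultimately show ?thesis using zero_D unfolding P_def by force
    qed
    then have "P (l *\<^sub>R - a) (l * b)" using l by (rule scale)
    moreover have "y = (- (l *\<^sub>R - a), l * b)" by (simp add: y)
    ultimately show "y \<in> {(- u, c) | u c. P u c}" by blast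
  qed
  ultimately have "convex hull {l *\<^sub>R v | l v. 0 \<le> l \<and> v \<in> neg_lift B 0 \<union> neg_lift A 1}
      \<subseteq> {(- u, c) | u c. P u c}" by (intro hull_minimal)
  with assms(2) show thesis using that unfolding P_def by blast
qed

context exterior_sphere_hypograph
begin

lemma horizontal_superdiff_eq:
  assumes "x \<in> \<Omega>" "pointed (N x)"
  shows "horizontal_superdiff \<Omega> f x = convex hull (horizontal_reachable_gradients \<Omega> f x \<union> {0})"
proof
  have "horizontal_reachable_gradients \<Omega> f x \<union> {0} \<subseteq> horizontal_superdiff \<Omega> f x"
    using horizontal_reachable_gradients_proximal[OF assms(1)]
      zero_in_proximal_normals[of "hypo \<Omega> f" "(x, f x)"]
    by (auto simp: neg_lift_def horizontal_superdiff_def zero_prod_def)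
  then show "convex hull (horizontal_reachable_gradients \<Omega> f x \<union> {0}) \<subseteq> horizontal_superdiff \<Omega> f x"
    by (intro hull_minimal convex_horizontal_superdiff)
  show "horizontal_superdiff \<Omega> f x \<subseteq> convex hull (horizontal_reachable_gradients \<Omega> f x \<union> {0})"
  proof
    fix v assume "v \<in> horizontal_superdiff \<Omega> f x"
    then have "(- v, 0) \<in> N x" by (simp add: horizontal_superdiff_def)
    then show "v \<in> convex hull (horizontal_reachable_gradients \<Omega> f x \<union> {0})"
      unfolding proximal_normals_eq_convex_hull[OF assms]
      by (rule convex_cone_hull_split[OF cone_horizontal_reachable_gradients]) auto
  qed
qed

text \<open>Splitting at height 1 gives one inclusion. For the other, adding a horizontal normal to
  \<open>(- a, 1)\<close> gives a proximal normal and keeps the height.\<close>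

lemma proximal_superdiff_eq:
  assumes "x \<in> \<Omega>" "pointed (N x)"
  shows "proximal_superdiff \<Omega> f x =
    {a + b | a b. a \<in> convex hull (reachable_gradients \<Omega> f x) \<and> b \<in> horizontal_superdiff \<Omega> f x}"
proof
  show "proximal_superdiff \<Omega> f x \<subseteq>
    {a + b | a b. a \<in> convex hull (reachable_gradients \<Omega> f x) \<and> b \<in> horizontal_superdiff \<Omega> f x}"
  proof
    fix v assume "v \<in> proximal_superdiff \<Omega> f x"
    then have "(- v, 1) \<in> N x" by (simp add: proximal_superdiff_def)
    then show "v \<in> {a + b | a b. a \<in> convex hull (reachable_gradients \<Omega> f x) \<and>
        b \<in> horizontal_superdiff \<Omega> f x}"
      unfolding proximal_normals_eq_convex_hull[OF assms] horizontal_superdiff_eq[OF assms]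
      by (rule convex_cone_hull_split[OF cone_horizontal_reachable_gradients]) auto
  qed
  have "reachable_gradients \<Omega> f x \<subseteq> proximal_superdiff \<Omega> f x"
    using reachable_gradients_proximal[OF assms(1)]
    by (auto simp: neg_lift_def proximal_superdiff_def)
  then have sub: "convex hull (reachable_gradients \<Omega> f x) \<subseteq> proximal_superdiff \<Omega> f x"
    by (intro hull_minimal convex_proximal_superdiff)
  have "a + b \<in> proximal_superdiff \<Omega> f x"
    if "a \<in> proximal_superdiff \<Omega> f x" "b \<in> horizontal_superdiff \<Omega> f x" for a b
    using that proximal_normals_add[of "(- a, 1)" "hypo \<Omega> f" "(x, f x)" "(- b, 0)"]
    by (simp add: proximal_superdiff_def horizontal_superdiff_def)
  with sub show "{a + b | a b. a \<in> convex hull (reachable_gradients \<Omega> f x) \<and>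
      b \<in> horizontal_superdiff \<Omega> f x} \<subseteq> proximal_superdiff \<Omega> f x" by blast
qed

end

theorem proposition2p10:
  fixes \<Omega> :: "(real ^ 'd) set"
    and f :: "real ^ 'd \<Rightarrow> real"
    and \<rho> :: "real ^ 'd \<Rightarrow> real"
  assumes "open \<Omega>"
    and "continuous_on \<Omega> f"
    and "continuous_on \<Omega> \<rho>"
    and "\<forall>x\<in>\<Omega>. 0 < \<rho> x"
    and "hypo_exterior_sphere \<Omega> f \<rho>"
  shows "\<forall>x\<in>\<Omega>.
    (reachable_gradients \<Omega> f x \<union> horizontal_reachable_gradients \<Omega> f x \<noteq> {} \<and>
     neg_lift (reachable_gradients \<Omega> f x) 1 \<union> neg_lift (horizontal_reachable_gradients \<Omega> f x) 0
       \<subseteq> proximal_normals (hypo \<Omega> f) (x, f x))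
    \<and>
    (\<forall>C. convex C \<and> closed C \<and> cone C \<and>
       neg_lift (reachable_gradients \<Omega> f x) 1 \<union> neg_lift (horizontal_reachable_gradients \<Omega> f x) 0
         \<subseteq> C \<and>
       C \<subseteq> proximal_normals (hypo \<Omega> f) (x, f x) \<longrightarrow>
       (\<forall>\<xi> l. 0 \<le> l \<and> norm (- \<xi>, l) = 1 \<and> (\<exists>R. exposed_ray R C \<and> (- \<xi>, l) \<in> R) \<longrightarrow>
          (- \<xi>, l) \<in> {\<zeta> /\<^sub>R norm \<zeta> | \<zeta>. \<zeta> \<in> neg_lift (reachable_gradients \<Omega> f x) 1}
                     \<union> neg_lift (horizontal_reachable_gradients \<Omega> f x) 0))
    \<and>
    (pointed (proximal_normals (hypo \<Omega> f) (x, f x)) \<longrightarrow>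
       closed (proximal_normals (hypo \<Omega> f) (x, f x)) \<and>
       proximal_normals (hypo \<Omega> f) (x, f x) =
         convex hull {l *\<^sub>R v | l v. 0 \<le> l \<and>
           v \<in> neg_lift (horizontal_reachable_gradients \<Omega> f x) 0
               \<union> neg_lift (reachable_gradients \<Omega> f x) 1} \<and>
       horizontal_superdiff \<Omega> f x =
         convex hull (horizontal_reachable_gradients \<Omega> f x \<union> {0}) \<and>
       proximal_superdiff \<Omega> f x =
         {a + b | a b. a \<in> convex hull (reachable_gradients \<Omega> f x) \<and>
                       b \<in> horizontal_superdiff \<Omega> f x})"
proof (intro ballI conjI allI impI; (elim conjE exE)?)
  interpret exterior_sphere_hypograph \<Omega> f \<rho>
    using assms by unfold_locales auto
  fix x assume x: "x \<in> \<Omega>"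
  show "reachable_gradients \<Omega> f x \<union> horizontal_reachable_gradients \<Omega> f x \<noteq> {}"
    using limiting_normals_nonempty[OF x] limiting_normals_subset[of \<Omega> f x]
    by (auto simp: neg_lift_def)
  show "neg_lift (reachable_gradients \<Omega> f x) 1 \<union> neg_lift (horizontal_reachable_gradients \<Omega> f x) 0
      \<subseteq> proximal_normals (hypo \<Omega> f) (x, f x)"
    using reachable_gradients_proximal[OF x] horizontal_reachable_gradients_proximal[OF x] by blast
  {
    fix C \<xi> l R
    assume "cone C" and sub: "neg_lift (reachable_gradients \<Omega> f x) 1
        \<union> neg_lift (horizontal_reachable_gradients \<Omega> f x) 0 \<subseteq> C"
      and C: "C \<subseteq> proximal_normals (hypo \<Omega> f) (x, f x)"
      and "norm (- \<xi>, l :: real) = 1" "exposed_ray R C" "(- \<xi>, l) \<in> R"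
    \<comment> \<open>Limiting normals are normalized generators or horizontal generators, so a cone
      containing the generators contains them.\<close>
    moreover have "\<zeta> /\<^sub>R norm \<zeta> \<in> C" if "\<zeta> \<in> C" for \<zeta>
      using \<open>cone C\<close> that by (simp add: mem_cone)
    with sub have "limiting_normals \<Omega> f x \<subseteq> C"
      using limiting_normals_subset[of \<Omega> f x] by blast
    ultimately have "(- \<xi>, l) \<in> limiting_normals \<Omega> f x"
      using exposed_unit_vector_is_limiting_normal[OF x C] by blast
    then show "(- \<xi>, l) \<in> {\<zeta> /\<^sub>R norm \<zeta> | \<zeta>. \<zeta> \<in> neg_lift (reachable_gradients \<Omega> f x) 1}
        \<union> neg_lift (horizontal_reachable_gradients \<Omega> f x) 0"
      using limiting_normals_subset by blast
  }
  assume pointed: "pointed (proximal_normals (hypo \<Omega> f) (x, f x))"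
  show "closed (proximal_normals (hypo \<Omega> f) (x, f x))"
    by (rule closed_proximal_normals[OF x pointed])
  show "proximal_normals (hypo \<Omega> f) (x, f x) =
      convex hull {l *\<^sub>R v | l v. 0 \<le> l \<and>
        v \<in> neg_lift (horizontal_reachable_gradients \<Omega> f x) 0
            \<union> neg_lift (reachable_gradients \<Omega> f x) 1}"
    by (rule proximal_normals_eq_convex_hull[OF x pointed])
  show "horizontal_superdiff \<Omega> f x = convex hull (horizontal_reachable_gradients \<Omega> f x \<union> {0})"
    by (rule horizontal_superdiff_eq[OF x pointed])
  show "proximal_superdiff \<Omega> f x = {a + b | a b. a \<in> convex hull (reachable_gradients \<Omega> f x) \<and>
      b \<in> horizontal_superdiff \<Omega> f x}"
    by (rule proximal_superdiff_eq[OF x pointed])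
qed

end
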